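(* Let $d>0$ and let $V_0:\mathbb{R}\to\mathbb{R}$ be continuous, even and $d$-periodic. Let $\mu_1$ be the first Dirichlet eigenvalue and $\nu_2$ the second Neumann eigenvalue of $-\partial_x^2+V_0$ on $[0,d]$. (a) If $V_0$ is strictly increasing on $[0,\frac d2]$, then $\nu_2<\mu_1$. The Neumann eigenfunction corresponding to $\nu_2$ is strictly monotone on $[0,d]$ and odd with respect to $\frac d2$. (b) If $V_0$ is strictly decreasing on $[0,\frac d2]$, then $\mu_1<\nu_2$. The Dirichlet eigenfunction corresponding to $\mu_1$ is strictly monotone on $[0,\frac d2]$ and even with respect to $\frac d2$.
   Context: For $k\in\mathbb{N}=\{1,2,\dots\}$, $\mu_k$ denotes the $k$-th Dirichlet eigenvalue of $-u''+V_0u=\mu u$ on $[0,d]$ (boundary conditions $u(0)=u(d)=0$) and $\nu_k$ the $k$-th Neumann eigenvalue of $-u''+V_0u=\nu u$ on $[0,d]$ (boundary conditions $u'(0)=u'(d)=0$), each sequence in increasing order. Even/odd with respect to $\frac d2$ means $u(d-x)=u(x)$, respectively $u(d-x)=-u(x)$, for $x\in[0,d]$. *)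

theory Defs
  imports Complex_Main
begin

text \<open>Classical solutions of \<open>-u'' + V u = \<mu> u\<close> on \<open>[0,d]\<close>, with \<open>v = u'\<close>. Derivatives are
  taken within \<open>[0,d]\<close>, hence one-sided at the endpoints, and the values of \<open>u\<close> and \<open>v\<close>
  outside the interval are irrelevant.\<close>

definition schroedinger_solution ::
    "(real \<Rightarrow> real) \<Rightarrow> real \<Rightarrow> real \<Rightarrow> (real \<Rightarrow> real) \<Rightarrow> (real \<Rightarrow> real) \<Rightarrow> bool" where
  "schroedinger_solution V d \<mu> u v \<longleftrightarrow>
     (\<exists>w. \<forall>x\<in>{0..d}.
        (u has_real_derivative v x) (at x within {0..d}) \<and>
        (v has_real_derivative w x) (at x within {0..d}) \<and>
        - w x + V x * u x = \<mu> * u x)"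

definition dirichlet_eigenfunction ::
    "(real \<Rightarrow> real) \<Rightarrow> real \<Rightarrow> real \<Rightarrow> (real \<Rightarrow> real) \<Rightarrow> bool" where
  "dirichlet_eigenfunction V d \<mu> u \<longleftrightarrow>
     (\<exists>x\<in>{0..d}. u x \<noteq> 0) \<and>
     (\<exists>v. schroedinger_solution V d \<mu> u v \<and> u 0 = 0 \<and> u d = 0)"

definition neumann_eigenfunction ::
    "(real \<Rightarrow> real) \<Rightarrow> real \<Rightarrow> real \<Rightarrow> (real \<Rightarrow> real) \<Rightarrow> bool" where
  "neumann_eigenfunction V d \<mu> u \<longleftrightarrow>
     (\<exists>x\<in>{0..d}. u x \<noteq> 0) \<and>
     (\<exists>v. schroedinger_solution V d \<mu> u v \<and> v 0 = 0 \<and> v d = 0)"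

text \<open>The \<open>k\<close>-th smallest element of a set of reals, counting from \<open>k = 1\<close>. The finiteness
  condition is needed because \<open>card\<close> is 0 on infinite sets.\<close>

definition kth_smallest :: "real set \<Rightarrow> nat \<Rightarrow> real" where
  "kth_smallest S k =
     (THE x. x \<in> S \<and> finite {y \<in> S. y < x} \<and> card {y \<in> S. y < x} + 1 = k)"

text \<open>All eigenvalues of these two problems are simple (a solution is determined up to a
  scalar by the boundary condition at \<open>0\<close>), so enumerating the set of eigenvalues agrees with
  enumerating eigenvalues according to multiplicity.\<close>

definition dirichlet_eigenvalue :: "(real \<Rightarrow> real) \<Rightarrow> real \<Rightarrow> nat \<Rightarrow> real" where
  "dirichlet_eigenvalue V d k = kth_smallest {\<mu>. \<exists>u. dirichlet_eigenfunction V d \<mu> u} k"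

definition neumann_eigenvalue :: "(real \<Rightarrow> real) \<Rightarrow> real \<Rightarrow> nat \<Rightarrow> real" where
  "neumann_eigenvalue V d k = kth_smallest {\<mu>. \<exists>u. neumann_eigenfunction V d \<mu> u} k"

definition even_about_midpoint :: "real \<Rightarrow> (real \<Rightarrow> real) \<Rightarrow> bool" where
  "even_about_midpoint d u \<longleftrightarrow> (\<forall>x\<in>{0..d}. u (d - x) = u x)"

definition odd_about_midpoint :: "real \<Rightarrow> (real \<Rightarrow> real) \<Rightarrow> bool" where
  "odd_about_midpoint d u \<longleftrightarrow> (\<forall>x\<in>{0..d}. u (d - x) = - u x)"

definition strictly_monotone_on :: "real set \<Rightarrow> (real \<Rightarrow> real) \<Rightarrow> bool" where
  "strictly_monotone_on A u \<longleftrightarrow> strict_mono_on A u \<or> strict_antimono_on A u"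

end

theory Submission
  imports Defs "HOL-Analysis.Analysis"
begin

text \<open>Put \<open>L = d/2\<close>. The potential is symmetric about \<open>L\<close>, so every eigenfunction on \<open>[0,d]\<close>
  is even or odd about \<open>L\<close>, and both spectra split into spectra of problems on \<open>[0,L]\<close>: an odd
  Neumann eigenfunction has \<open>u'(0) = 0 = u(L)\<close>, an even Dirichlet eigenfunction has
  \<open>u(0) = 0 = u'(L)\<close>. The second Neumann eigenvalue \<open>\<nu>\<close> is the lowest eigenvalue of the first mixed
  problem, and the first Dirichlet eigenvalue \<open>\<mu>\<close> is the lowest eigenvalue of the second. The
  reflection \<open>x \<mapsto> L - x\<close> turns the second mixed problem for \<open>V\<close> into the first one for
  \<open>V (L - x)\<close>. Hence the comparison in part (b) is that of part (a) for the
  reflected potential, and one analysis of the first mixed problem serves for both eigenvalues.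

  For that problem let \<open>c \<mu>\<close> be the solution with \<open>c(0) = 1\<close>, \<open>c'(0) = 0\<close>, which exists by Picard
  iteration and depends continuously on \<open>\<mu>\<close> by Gronwall's inequality. The lowest eigenvalue is the
  infimum of all \<open>\<mu>\<close> for which \<open>c \<mu>\<close> has a node in \<open>[0,L]\<close>. At this level the first node has just
  entered the interval, and it can do so only through the endpoint \<open>L\<close>, because a nonnegative
  solution with an interior zero would vanish identically (\<open>ground_state\<close>). Below this
  level \<open>c \<mu>\<close> has no node, and there is exactly one \<open>\<mu>\<close> with \<open>c'(L) = 0\<close>. That one is the first
  Neumann eigenvalue on \<open>[0,d]\<close>, which is why the level itself is the second.

  If the potential increases on \<open>[0,L]\<close>, then \<open>c'' = (V - \<nu>) c\<close> is first negative and possibly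
  positive later, while \<open>c'\<close> starts at \<open>0\<close> and ends negative, so \<open>c' < 0\<close> throughout; this gives the
  monotonicity statements. For the comparison let \<open>w > 0\<close> solve the second mixed problem at
  level \<open>\<mu>\<close>. Then
  \<open>(c' w')' = (V - \<nu>) (c w)' + (\<nu> - \<mu>) c' w\<close>.
  Both \<open>c' w'\<close> and \<open>c w\<close> vanish at \<open>0\<close> and \<open>L\<close>. If \<open>\<mu> \<le> \<nu>\<close>, the last term is not positive, and
  integrating yields \<open>0 \<le> \<integral> (V - \<nu>) d(c w) = - \<integral> c w dV < 0\<close>, a contradiction.
  Since \<open>V\<close> need not be differentiable, the last integration by parts is replaced by
  \<open>monotone_weight_integral_bound\<close>.\<close>

section \<open>Calculus with one-sided derivatives at endpoints\<close>

lemma mean_value_within: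
  fixes f f' :: "real \<Rightarrow> real"
  assumes "x < y" "{x..y} \<subseteq> S"
    and "\<And>t. t \<in> {x..y} \<Longrightarrow> (f has_real_derivative f' t) (at t within S)"
  obtains t where "x < t" "t < y" "f y - f x = f' t * (y - x)"
proof -
  have "\<exists>t\<in>{x<..<y}. f y - f x = (\<lambda>h. f' t * h) (y - x)"
  proof (rule mvt_simple[OF \<open>x < y\<close>])
    fix t assume "x \<le> t" "t \<le> y"
    then have "(f has_real_derivative f' t) (at t within {x..y})"
      using assms(2,3) by (auto intro: DERIV_subset)
    then show "(f has_derivative (\<lambda>h. f' t * h)) (at t within {x..y})"
      by (simp add: has_field_derivative_def)
  qed
  then show ?thesis
    using that by auto
qed

lemma nondecreasing_within:
  fixes f f' :: "real \<Rightarrow> real"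
  assumes "x \<le> y" "{x..y} \<subseteq> S"
    and "\<And>t. t \<in> {x..y} \<Longrightarrow> (f has_real_derivative f' t) (at t within S)"
    and "\<And>t. x < t \<Longrightarrow> t < y \<Longrightarrow> 0 \<le> f' t"
  shows "f x \<le> f y"
proof (cases "x = y")
  case False
  then have "x < y"
    using \<open>x \<le> y\<close> by simp
  from this assms(2,3) obtain t where "x < t" "t < y" "f y - f x = f' t * (y - x)"
    by (rule mean_value_within)
  moreover have "0 \<le> f' t * (y - x)"
    using assms(1,4) calculation by simp
  ultimately show ?thesis by linarith
qed simp

lemma strictly_increasing_within:
  fixes f f' :: "real \<Rightarrow> real"
  assumes "x < y" "{x..y} \<subseteq> S"
    and "\<And>t. t \<in> {x..y} \<Longrightarrow> (f has_real_derivative f' t) (at t within S)"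
    and "\<And>t. x < t \<Longrightarrow> t < y \<Longrightarrow> 0 < f' t"
  shows "f x < f y"
proof -
  from assms(1-3) obtain t where "x < t" "t < y" "f y - f x = f' t * (y - x)"
    by (rule mean_value_within)
  moreover have "0 < f' t * (y - x)"
    using assms(1,4) calculation by simp
  ultimately show ?thesis by linarith
qed

text \<open>The factor \<open>k\<close> carries the sign of the derivative, so that eigenfunctions need not be
  normalised before their monotonicity is established.\<close>
lemma strictly_monotone_on_if_derivative_sign:
  assumes "{a..b} \<subseteq> S"
    and "\<And>x. x \<in> {a..b} \<Longrightarrow> (u has_real_derivative v x) (at x within S)"
    and "\<And>x. a < x \<Longrightarrow> x < b \<Longrightarrow> k * v x > 0"
  shows "strictly_monotone_on {a..b} u"
proof -
  have *: "k * u x < k * u y" if "x \<in> {a..b}" "y \<in> {a..b}" "x < y" for x y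
  proof (rule strictly_increasing_within[OF \<open>x < y\<close>, where S = S and f' = "\<lambda>t. k * v t"])
    show "{x..y} \<subseteq> S"
      using assms(1) that by auto
    show "((\<lambda>t. k * u t) has_real_derivative k * v t) (at t within S)" if "t \<in> {x..y}" for t
      using assms(2) that \<open>x \<in> _\<close> \<open>y \<in> _\<close> by (intro DERIV_cmult) auto
    show "0 < k * v t" if "x < t" "t < y" for t
      using assms(3) that \<open>x \<in> _\<close> \<open>y \<in> _\<close> by auto
  qed
  show ?thesis
  proof (cases "k > 0")
    case True
    then show ?thesis
      using * by (auto simp: strictly_monotone_on_def monotone_on_def)
  next
    case False
    have "u y < u x" if "x \<in> {a..b}" "y \<in> {a..b}" "x < y" for x y
      using *[OF that] False by (smt (verit) mult_le_cancel_left_neg mult_eq_0_iff mult_cancel_left)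
    then show ?thesis
      by (auto simp: strictly_monotone_on_def monotone_on_def)
  qed
qed

lemma abs_le_of_derivative_bound:
  fixes f g f' g' :: "real \<Rightarrow> real"
  assumes "a \<le> x" "{a..x} \<subseteq> S" "f a = 0" "g a = 0"
    and "\<And>t. t \<in> {a..x} \<Longrightarrow> (f has_real_derivative f' t) (at t within S)"
    and "\<And>t. t \<in> {a..x} \<Longrightarrow> (g has_real_derivative g' t) (at t within S)"
    and "\<And>t. t \<in> {a..x} \<Longrightarrow> \<bar>f' t\<bar> \<le> g' t"
  shows "\<bar>f x\<bar> \<le> g x"
proof -
  have "g a - f a \<le> g x - f x"
    using assms(5-7) by (intro nondecreasing_within[OF assms(1,2), where f' = "\<lambda>t. g' t - f' t"])
      (auto intro!: derivative_intros simp: abs_le_iff)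
  moreover have "g a + f a \<le> g x + f x"
  proof (rule nondecreasing_within[OF assms(1,2), where f' = "\<lambda>t. g' t + f' t"])
    show "0 \<le> g' t + f' t" if "a < t" "t < x" for t
      using assms(7)[of t] that by auto
  qed (use assms(5,6) in \<open>auto intro!: derivative_intros\<close>)
  ultimately show ?thesis
    using assms(3,4) by simp
qed

text \<open>The function \<open>exp (- K (x - a)) E x\<close> grows at rate at most \<open>\<eta>\<close>.\<close>
lemma gronwall:
  fixes E E' :: "real \<Rightarrow> real"
  assumes "a \<le> b" "{a..b} \<subseteq> S" "0 \<le> K" "0 \<le> \<eta>"
    and der: "\<And>x. x \<in> {a..b} \<Longrightarrow> (E has_real_derivative E' x) (at x within S)"
    and bound: "\<And>x. x \<in> {a..b} \<Longrightarrow> E' x \<le> K * E x + \<eta>"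
  shows "E b \<le> exp (K * (b - a)) * (E a + \<eta> * (b - a))"
proof -
  define G where "G x = \<eta> * x - exp (- K * (x - a)) * E x" for x
  define G' where "G' x = \<eta> - exp (- K * (x - a)) * (E' x - K * E x)" for x
  have "G a \<le> G b"
  proof (rule nondecreasing_within[OF \<open>a \<le> b\<close> \<open>{a..b} \<subseteq> S\<close>, where f' = G'])
    show "(G has_real_derivative G' x) (at x within S)" if "x \<in> {a..b}" for x
      unfolding G_def G'_def
      by (rule derivative_eq_intros der that refl | simp add: algebra_simps)+
    show "0 \<le> G' x" if "a < x" "x < b" for x
    proof -
      have "exp (- K * (x - a)) * (E' x - K * E x) \<le> exp (- K * (x - a)) * \<eta>"
        using bound[of x] that by (intro mult_left_mono) auto
      also have "\<dots> \<le> 1 * \<eta>"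
        using that assms by (intro mult_right_mono) auto
      finally show ?thesis
        by (simp add: G'_def)
    qed
  qed
  then have "exp (- K * (b - a)) * E b \<le> E a + \<eta> * (b - a)"
    by (simp add: G_def algebra_simps)
  then have "exp (K * (b - a)) * (exp (- K * (b - a)) * E b) \<le> exp (K * (b - a)) * (E a + \<eta> * (b - a))"
    by (intro mult_left_mono) auto
  then show ?thesis
    by (simp add: mult.assoc[symmetric] exp_minus)
qed

section \<open>Linear theory of the Schroedinger equation\<close>

lemma schroedinger_solution_iff:
  "schroedinger_solution V d \<mu> u v \<longleftrightarrow>
     (\<forall>x\<in>{0..d}. (u has_real_derivative v x) (at x within {0..d}) \<and>
        (v has_real_derivative (V x - \<mu>) * u x) (at x within {0..d}))"
proof
  assume "schroedinger_solution V d \<mu> u v"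
  then obtain w where w: "\<And>x. x \<in> {0..d} \<Longrightarrow> (u has_real_derivative v x) (at x within {0..d}) \<and>
        (v has_real_derivative w x) (at x within {0..d}) \<and> - w x + V x * u x = \<mu> * u x"
    unfolding schroedinger_solution_def by blast
  have "w x = (V x - \<mu>) * u x" if "x \<in> {0..d}" for x
    using w[OF that] by (simp add: algebra_simps)
  then show "\<forall>x\<in>{0..d}. (u has_real_derivative v x) (at x within {0..d}) \<and>
        (v has_real_derivative (V x - \<mu>) * u x) (at x within {0..d})"
    using w by metis
next
  assume "\<forall>x\<in>{0..d}. (u has_real_derivative v x) (at x within {0..d}) \<and>
        (v has_real_derivative (V x - \<mu>) * u x) (at x within {0..d})"
  then show "schroedinger_solution V d \<mu> u v"
    unfolding schroedinger_solution_def
    by (intro exI[of _ "\<lambda>x. (V x - \<mu>) * u x"]) (auto simp: algebra_simps)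
qed

lemma schroedinger_solution_derivatives:
  assumes "schroedinger_solution V d \<mu> u v" "x \<in> {0..d}"
  shows "(u has_real_derivative v x) (at x within {0..d})"
    and "(v has_real_derivative (V x - \<mu>) * u x) (at x within {0..d})"
  using assms by (auto simp: schroedinger_solution_iff)

lemma schroedinger_solution_continuous:
  assumes "schroedinger_solution V d \<mu> u v"
  shows "continuous_on {0..d} u" and "continuous_on {0..d} v"
  by (rule DERIV_continuous_on[OF schroedinger_solution_derivatives(1)[OF assms]], assumption)
     (rule DERIV_continuous_on[OF schroedinger_solution_derivatives(2)[OF assms]], assumption)

lemma schroedinger_solution_restrict:
  assumes "schroedinger_solution V d \<mu> u v" "e \<le> d"
  shows "schroedinger_solution V e \<mu> u v"
  unfolding schroedinger_solution_iff
proof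
  fix x assume x: "x \<in> {0..e}"
  then have *: "x \<in> {0..d}" and sub: "{0..e} \<subseteq> {0..d}"
    using \<open>e \<le> d\<close> by auto
  show "(u has_real_derivative v x) (at x within {0..e}) \<and>
        (v has_real_derivative (V x - \<mu>) * u x) (at x within {0..e})"
    using schroedinger_solution_derivatives[OF assms(1) *] DERIV_subset[OF _ sub] by blast
qed

lemma schroedinger_solution_linear_combination:
  assumes "schroedinger_solution V d \<mu> u v" "schroedinger_solution V d \<mu> u' v'"
  shows "schroedinger_solution V d \<mu> (\<lambda>x. a * u x + b * u' x) (\<lambda>x. a * v x + b * v' x)"
  unfolding schroedinger_solution_iff
proof
  fix x assume x: "x \<in> {0..d}"
  note D = schroedinger_solution_derivatives[OF assms(1) x] schroedinger_solution_derivatives[OF assms(2) x]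
  show "((\<lambda>x. a * u x + b * u' x) has_real_derivative a * v x + b * v' x) (at x within {0..d}) \<and>
        ((\<lambda>x. a * v x + b * v' x) has_real_derivative (V x - \<mu>) * (a * u x + b * u' x)) (at x within {0..d})"
    by (auto intro!: derivative_eq_intros D simp: algebra_simps)
qed

lemma schroedinger_solution_reflect:
  assumes "schroedinger_solution V d \<mu> u v" "\<And>x. x \<in> {0..d} \<Longrightarrow> W x = V (d - x)"
  shows "schroedinger_solution W d \<mu> (\<lambda>x. u (d - x)) (\<lambda>x. - v (d - x))"
  unfolding schroedinger_solution_iff
proof
  fix x assume x: "x \<in> {0..d}"
  then have x': "d - x \<in> {0..d}" by auto
  have im: "(\<lambda>x. d - x) ` {0..d} = {0..d}" by simp
  have R: "((\<lambda>x. d - x) has_real_derivative -1) (at x within {0..d})"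
    by (rule derivative_eq_intros refl | simp)+
  have chain: "((\<lambda>x. f (d - x)) has_real_derivative - D) (at x within {0..d})"
    if "(f has_real_derivative D) (at (d - x) within {0..d})" for f D
    using DERIV_image_chain[of f D "\<lambda>x. d - x", OF _ R] that im by (simp add: o_def)
  show "((\<lambda>x. u (d - x)) has_real_derivative - v (d - x)) (at x within {0..d}) \<and>
        ((\<lambda>x. - v (d - x)) has_real_derivative (W x - \<mu>) * u (d - x)) (at x within {0..d})"
    using chain[OF schroedinger_solution_derivatives(1)[OF assms(1) x']]
      DERIV_minus[OF chain[OF schroedinger_solution_derivatives(2)[OF assms(1) x']]]
    by (simp add: assms(2)[OF x])
qed

text \<open>Multiplying each equation by the other solution and subtracting cancels the potential, so only
  the difference of the spectral parameters remains.\<close>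
lemma wronskian_derivative:
  assumes "schroedinger_solution V d \<mu> u v" "schroedinger_solution V d \<mu>' u' v'" "x \<in> {0..d}"
  shows "((\<lambda>x. v x * u' x - u x * v' x) has_real_derivative (\<mu>' - \<mu>) * (u x * u' x)) (at x within {0..d})"
proof -
  note D = schroedinger_solution_derivatives[OF assms(1,3)] schroedinger_solution_derivatives[OF assms(2,3)]
  show ?thesis
    by (auto intro!: derivative_eq_intros D simp: algebra_simps)
qed

lemma wronskian_constant:
  assumes "schroedinger_solution V d \<mu> u v" "schroedinger_solution V d \<mu> u' v'"
    and "x \<in> {0..d}" "y \<in> {0..d}"
  shows "v x * u' x - u x * v' x = v y * u' y - u y * v' y"
proof -
  have "((\<lambda>x. v x * u' x - u x * v' x) has_real_derivative 0) (at x within {0..d})" if "x \<in> {0..d}" for x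
    using wronskian_derivative[OF assms(1,2) that] by simp
  from has_field_derivative_zero_constant[OF _ this] obtain C where
    "\<forall>x\<in>{0..d}. v x * u' x - u x * v' x = C" by auto
  then show ?thesis
    using assms(3,4) by auto
qed

lemma abs_bound_on_interval:
  fixes f :: "real \<Rightarrow> real"
  assumes "continuous_on {a..b} f"
  obtains B where "0 \<le> B" "\<And>x. x \<in> {a..b} \<Longrightarrow> \<bar>f x\<bar> \<le> B"
proof -
  have "bounded (f ` {a..b})"
    using assms by (intro compact_imp_bounded compact_continuous_image) auto
  then obtain B where "B > 0" "\<forall>y\<in>f ` {a..b}. norm y \<le> B"
    by (meson bounded_pos)
  then show ?thesis
    by (intro that[of B]) auto
qed

text \<open>The squared distance of the solutions in phase space satisfies a linear differential inequality,
  with growth rate \<open>2 + K\<close> and source \<open>((\<mu> - \<mu>') B)\<^sup>2\<close>. For \<open>\<mu> = \<mu>'\<close> this is uniqueness to the right of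
  the initial point; in general it is continuous dependence on the spectral parameter.\<close>
lemma schroedinger_solution_dependence:
  assumes "schroedinger_solution V d \<mu> u v" "schroedinger_solution V d \<mu>' u' v'"
    and V: "\<And>x. x \<in> {0..d} \<Longrightarrow> \<bar>V x - \<mu>\<bar> \<le> K"
    and B: "\<And>x. x \<in> {0..d} \<Longrightarrow> \<bar>u' x\<bar> \<le> B"
    and "u a = u' a" "v a = v' a" "0 \<le> a" "a \<le> x" "x \<le> d"
  shows "(u x - u' x)\<^sup>2 + (v x - v' x)\<^sup>2 \<le> exp ((2 + K) * (x - a)) * (((\<mu> - \<mu>') * B)\<^sup>2 * (x - a))"
proof -
  define E where "E x = (u x - u' x)\<^sup>2 + (v x - v' x)\<^sup>2" for x
  define E' where "E' x = 2 * (u x - u' x) * (v x - v' x) +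
    2 * (v x - v' x) * ((V x - \<mu>) * u x - (V x - \<mu>') * u' x)" for x
  have sub: "{a..x} \<subseteq> {0..d}"
    using assms by auto
  have "a \<in> {0..d}"
    using assms by auto
  then have K: "0 \<le> K"
    using V[of a] by linarith
  have "E x \<le> exp ((2 + K) * (x - a)) * (E a + ((\<mu> - \<mu>') * B)\<^sup>2 * (x - a))"
  proof (rule gronwall[OF \<open>a \<le> x\<close> sub, where E' = E'])
    fix t assume "t \<in> {a..x}"
    then have t: "t \<in> {0..d}"
      using sub by auto
    note D = schroedinger_solution_derivatives[OF assms(1) t] schroedinger_solution_derivatives[OF assms(2) t]
    show "(E has_real_derivative E' t) (at t within {0..d})"
      unfolding E_def E'_def
      by (auto intro!: derivative_eq_intros D simp: algebra_simps)
    define e f where "e = u t - u' t" and "f = v t - v' t"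
    have "E' t = 2 * (e * f) * (1 + (V t - \<mu>)) + 2 * (f * ((\<mu>' - \<mu>) * u' t))"
      by (simp add: E'_def e_def f_def algebra_simps)
    also have "2 * (e * f) * (1 + (V t - \<mu>)) \<le> \<bar>2 * (e * f)\<bar> * \<bar>1 + (V t - \<mu>)\<bar>"
      by (metis abs_ge_self abs_mult)
    also have "\<dots> \<le> (e\<^sup>2 + f\<^sup>2) * (1 + K)"
    proof (rule mult_mono)
      show "\<bar>2 * (e * f)\<bar> \<le> e\<^sup>2 + f\<^sup>2"
        using sum_squares_bound[of "\<bar>e\<bar>" "\<bar>f\<bar>"] by (simp add: abs_mult)
      show "\<bar>1 + (V t - \<mu>)\<bar> \<le> 1 + K"
        using V[OF t] by linarith
    qed auto
    also have "2 * (f * ((\<mu>' - \<mu>) * u' t)) \<le> f\<^sup>2 + ((\<mu>' - \<mu>) * u' t)\<^sup>2"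
      using sum_squares_bound[of f "(\<mu>' - \<mu>) * u' t"] by simp
    also have "((\<mu>' - \<mu>) * u' t)\<^sup>2 \<le> ((\<mu> - \<mu>') * B)\<^sup>2"
      unfolding power_mult_distrib power2_commute[of \<mu>' \<mu>]
      using power_mono[OF B[OF t], of 2] by (intro mult_left_mono) auto
    finally show "E' t \<le> (2 + K) * E t + ((\<mu> - \<mu>') * B)\<^sup>2"
      unfolding E_def e_def[symmetric] f_def[symmetric]
      by (simp add: algebra_simps) (smt (verit) zero_le_power2)
  qed (use K in auto)
  then show ?thesis
    using assms by (simp add: E_def)
qed

text \<open>The solution vanishes to the right of \<open>a\<close> by the energy estimate against the zero solution, and
  to the left of \<open>a\<close> by the same estimate for the reflected equation.\<close>
lemma schroedinger_solution_eq_zero: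
  assumes sol: "schroedinger_solution V d \<mu> u v" and V: "continuous_on {0..d} V"
    and a: "a \<in> {0..d}" "u a = 0" "v a = 0" and x: "x \<in> {0..d}"
  shows "u x = 0 \<and> v x = 0"
proof -
  have forward: "u x = 0 \<and> v x = 0"
    if "schroedinger_solution V d \<mu> u v" "continuous_on {0..d} V"
      "u a = 0" "v a = 0" "0 \<le> a" "a \<le> x" "x \<le> d" for V u v a x
  proof -
    have "continuous_on {0..d} (\<lambda>x. V x - \<mu>)"
      using that(2) by (intro continuous_intros)
    then obtain K where "\<And>x. x \<in> {0..d} \<Longrightarrow> \<bar>V x - \<mu>\<bar> \<le> K"
      using abs_bound_on_interval by blast
    moreover have "schroedinger_solution V d \<mu> (\<lambda>_. 0) (\<lambda>_. 0)"
      by (auto simp: schroedinger_solution_iff)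
    ultimately have "(u x - 0)\<^sup>2 + (v x - 0)\<^sup>2 \<le> exp ((2 + K) * (x - a)) * (((\<mu> - \<mu>) * 0)\<^sup>2 * (x - a))"
      using that by (intro schroedinger_solution_dependence[where V = V and d = d and u' = "\<lambda>_. 0" and v' = "\<lambda>_. 0"]) auto
    then show ?thesis
      by (simp add: sum_power2_le_zero_iff)
  qed
  show ?thesis
  proof (cases "a \<le> x")
    case True
    then show ?thesis
      using forward[OF sol V a(2,3)] a(1) x by simp
  next
    case False
    have sol': "schroedinger_solution (\<lambda>x. V (d - x)) d \<mu> (\<lambda>x. u (d - x)) (\<lambda>x. - v (d - x))"
      using sol by (rule schroedinger_solution_reflect) simp
    have V': "continuous_on {0..d} (\<lambda>x. V (d - x))"
      by (rule continuous_on_compose2[OF V]) (auto intro!: continuous_intros)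
    show ?thesis
      using forward[OF sol' V', of "d - a" "d - x"] False a x by simp
  qed
qed

lemma schroedinger_solution_unique:
  assumes "schroedinger_solution V d \<mu> u v" "schroedinger_solution V d \<mu> u' v'" "continuous_on {0..d} V"
    and "a \<in> {0..d}" "u a = k * u' a" "v a = k * v' a" "x \<in> {0..d}"
  shows "u x = k * u' x" and "v x = k * v' x"
proof -
  have "schroedinger_solution V d \<mu> (\<lambda>x. 1 * u x + (- k) * u' x) (\<lambda>x. 1 * v x + (- k) * v' x)"
    using assms(1,2) by (rule schroedinger_solution_linear_combination)
  from schroedinger_solution_eq_zero[OF this assms(3,4) _ _ assms(7)]
  show "u x = k * u' x" and "v x = k * v' x"
    using assms(5,6) by auto
qed

lemma schroedinger_solution_nontrivial:
  assumes "schroedinger_solution V d \<mu> u v" "continuous_on {0..d} V"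
    and "\<exists>x\<in>{0..d}. u x \<noteq> 0" "a \<in> {0..d}"
  shows "u a \<noteq> 0 \<or> v a \<noteq> 0"
  using schroedinger_solution_eq_zero[OF assms(1,2,4)] assms(3) by blast

section \<open>Existence of solutions by Picard iteration\<close>

text \<open>The solution of \<open>u'' = q u\<close> with \<open>u(0) = a\<close>, \<open>u'(0) = b\<close> is the sum of the terms below: the
  zeroth is the solution for \<open>q = 0\<close>, and the second derivative of each further term is \<open>q\<close> times the
  preceding one.\<close>

primrec picard_term :: "(real \<Rightarrow> real) \<Rightarrow> real \<Rightarrow> real \<Rightarrow> nat \<Rightarrow> real \<Rightarrow> real" where
  "picard_term q a b 0 = (\<lambda>x. a + b * x)"
| "picard_term q a b (Suc n) =
     (\<lambda>x. integral {0..x} (\<lambda>s. integral {0..s} (\<lambda>t. q t * picard_term q a b n t)))"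

primrec picard_slope :: "(real \<Rightarrow> real) \<Rightarrow> real \<Rightarrow> real \<Rightarrow> nat \<Rightarrow> real \<Rightarrow> real" where
  "picard_slope q a b 0 = (\<lambda>x. b)"
| "picard_slope q a b (Suc n) = (\<lambda>x. integral {0..x} (\<lambda>t. q t * picard_term q a b n t))"

primrec picard_curvature :: "(real \<Rightarrow> real) \<Rightarrow> real \<Rightarrow> real \<Rightarrow> nat \<Rightarrow> real \<Rightarrow> real" where
  "picard_curvature q a b 0 = (\<lambda>x. 0)"
| "picard_curvature q a b (Suc n) = (\<lambda>x. q x * picard_term q a b n x)"

lemma picard_derivatives:
  assumes q: "continuous_on {0..d} q" and x: "x \<in> {0..d}"
  shows "(picard_term q a b n has_real_derivative picard_slope q a b n x) (at x within {0..d})"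
    and "(picard_slope q a b n has_real_derivative picard_curvature q a b n x) (at x within {0..d})"
proof -
  have slope: "((\<lambda>x. integral {0..x} (\<lambda>t. q t * picard_term q a b n t)) has_real_derivative
      q x * picard_term q a b n x) (at x within {0..d})"
    if "continuous_on {0..d} (picard_term q a b n)" "x \<in> {0..d}" for n x
    using that q by (intro integral_has_real_derivative continuous_on_mult)
  have iterate: "(picard_term q a b (Suc n) has_real_derivative picard_slope q a b (Suc n) x) (at x within {0..d})"
    if "continuous_on {0..d} (picard_term q a b n)" "x \<in> {0..d}" for n x
    unfolding picard_term.simps picard_slope.simps
    using that DERIV_continuous_on[OF slope[OF that(1)]] by (intro integral_has_real_derivative)
  have cont: "continuous_on {0..d} (picard_term q a b n)" for n
  proof (induction n)
    case 0
    then show ?case by (auto intro!: continuous_intros)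
  next
    case (Suc n)
    show ?case
      by (rule DERIV_continuous_on[OF iterate[OF Suc]])
  qed
  show "(picard_term q a b n has_real_derivative picard_slope q a b n x) (at x within {0..d})"
  proof (cases n)
    case 0
    then show ?thesis by (auto intro!: derivative_eq_intros)
  next
    case (Suc m)
    then show ?thesis using iterate[OF cont x, of m] by blast
  qed
  show "(picard_slope q a b n has_real_derivative picard_curvature q a b n x) (at x within {0..d})"
  proof (cases n)
    case (Suc m)
    then show ?thesis using slope[OF cont x, of m] by simp
  qed simp
qed

text \<open>Of the two integrations in each step, the first contributes \<open>x / (n + 1)\<close> and hence the
  factorial that makes the series converge; for the second the crude factor \<open>d\<close> suffices.\<close>
lemma picard_term_bound:
  assumes q: "continuous_on {0..d} q" and K: "\<And>x. x \<in> {0..d} \<Longrightarrow> \<bar>q x\<bar> \<le> K" and x: "x \<in> {0..d}"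
  shows "\<bar>picard_term q a b n x\<bar> \<le> (\<bar>a\<bar> + \<bar>b\<bar> * d) * (K * d) ^ n * x ^ n / fact n"
  using x
proof (induction n arbitrary: x)
  case 0
  have "\<bar>a + b * x\<bar> \<le> \<bar>a\<bar> + \<bar>b * x\<bar>"
    by (rule abs_triangle_ineq)
  also have "\<bar>b * x\<bar> \<le> \<bar>b\<bar> * d"
    using 0 by (auto simp: abs_mult intro!: mult_left_mono)
  finally show ?case by simp
next
  case (Suc n)
  define C where "C = K * ((\<bar>a\<bar> + \<bar>b\<bar> * d) * (K * d) ^ n)"
  have K0: "0 \<le> K"
    using K[OF Suc.prems] by linarith
  have C: "0 \<le> C"
    using K0 Suc.prems by (auto simp: C_def)
  have slope: "\<bar>picard_slope q a b (Suc n) s\<bar> \<le> C * s ^ Suc n / fact (Suc n)" if s: "s \<in> {0..x}" for s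
  proof (rule abs_le_of_derivative_bound[where a = 0 and S = "{0..d}"
        and f = "picard_slope q a b (Suc n)" and f' = "picard_curvature q a b (Suc n)"
        and g = "\<lambda>t. C * t ^ Suc n / fact (Suc n)" and g' = "\<lambda>t. C * t ^ n / fact n"])
    fix t assume "t \<in> {0..s}"
    then have t: "t \<in> {0..d}"
      using s Suc.prems by auto
    then show "(picard_slope q a b (Suc n) has_real_derivative picard_curvature q a b (Suc n) t) (at t within {0..d})"
      by (rule picard_derivatives[OF q])
    have "((\<lambda>t. C / fact (Suc n) * t ^ Suc n) has_real_derivative
        C / fact (Suc n) * (real (Suc n) * t ^ (Suc n - Suc 0))) (at t within {0..d})"
      by (intro DERIV_cmult DERIV_pow)
    moreover have "C / fact (Suc n) * (real (Suc n) * t ^ (Suc n - Suc 0)) = C * t ^ n / fact n"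
      by (simp add: fact_Suc del: of_nat_Suc)
    ultimately show "((\<lambda>t. C * t ^ Suc n / fact (Suc n)) has_real_derivative C * t ^ n / fact n) (at t within {0..d})"
      by simp
    have "\<bar>q t\<bar> * \<bar>picard_term q a b n t\<bar> \<le> K * ((\<bar>a\<bar> + \<bar>b\<bar> * d) * (K * d) ^ n * t ^ n / fact n)"
      using K0 by (intro mult_mono K Suc.IH t) auto
    then show "\<bar>picard_curvature q a b (Suc n) t\<bar> \<le> C * t ^ n / fact n"
      by (simp add: abs_mult C_def mult.assoc)
  qed (use s Suc.prems in auto)
  have "\<bar>picard_term q a b (Suc n) x\<bar> \<le> C * x ^ Suc n / fact (Suc n) * x"
  proof (rule abs_le_of_derivative_bound[where a = 0 and S = "{0..d}"
        and f = "picard_term q a b (Suc n)" and f' = "picard_slope q a b (Suc n)"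
        and g = "\<lambda>t. C * x ^ Suc n / fact (Suc n) * t" and g' = "\<lambda>t. C * x ^ Suc n / fact (Suc n)"])
    fix t assume t: "t \<in> {0..x}"
    show "(picard_term q a b (Suc n) has_real_derivative picard_slope q a b (Suc n) t) (at t within {0..d})"
      using t Suc.prems by (intro picard_derivatives[OF q]) auto
    show "((\<lambda>t. C * x ^ Suc n / fact (Suc n) * t) has_real_derivative C * x ^ Suc n / fact (Suc n)) (at t within {0..d})"
      by (auto intro!: derivative_eq_intros)
    show "\<bar>picard_slope q a b (Suc n) t\<bar> \<le> C * x ^ Suc n / fact (Suc n)"
      using slope[OF t] C t
      by (elim order_trans) (intro divide_right_mono mult_left_mono power_mono, auto)
  qed (use Suc.prems in auto)
  also have "\<dots> \<le> C * x ^ Suc n / fact (Suc n) * d"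
    using C Suc.prems by (intro mult_left_mono) auto
  finally show ?case
    by (simp add: C_def ac_simps)
qed

text \<open>The series of the second derivatives and of the slopes converge uniformly by the factorial
  bound, so the series may be differentiated termwise twice.\<close>
lemma schroedinger_solution_exists:
  assumes V: "continuous_on {0..d} V" and d: "0 \<le> d"
  obtains u v where "schroedinger_solution V d \<mu> u v" "u 0 = a" "v 0 = b"
proof -
  define q where "q x = V x - \<mu>" for x
  have q: "continuous_on {0..d} q"
    unfolding q_def using V by (intro continuous_intros)
  then obtain K where K0: "0 \<le> K" and K: "\<And>x. x \<in> {0..d} \<Longrightarrow> \<bar>q x\<bar> \<le> K"
    using abs_bound_on_interval by blast
  define B where "B = \<bar>a\<bar> + \<bar>b\<bar> * d"
  define M where "M n = K * (B * ((K * d * d) ^ n / fact n))" for n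
  have B: "0 \<le> B"
    using d by (simp add: B_def)
  have M0: "0 \<le> M n" for n
    using K0 B d by (simp add: M_def)
  have "summable (\<lambda>n. inverse (fact n) * (K * d * d) ^ n)"
    by (rule summable_exp)
  then have M: "summable M"
    unfolding M_def by (intro summable_mult) (simp add: divide_inverse mult.commute)
  have curvature: "\<bar>picard_curvature q a b (Suc n) x\<bar> \<le> M n" if "x \<in> {0..d}" for n x
  proof -
    have "\<bar>picard_term q a b n x\<bar> \<le> B * (K * d) ^ n * x ^ n / fact n"
      unfolding B_def by (rule picard_term_bound[OF q K that])
    also have "\<dots> \<le> B * (K * d) ^ n * d ^ n / fact n"
      using that K0 B d by (intro divide_right_mono mult_left_mono power_mono) auto
    finally have "\<bar>q x\<bar> * \<bar>picard_term q a b n x\<bar> \<le> K * (B * (K * d) ^ n * d ^ n / fact n)"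
      using K[OF that] K0 by (intro mult_mono) auto
    then show ?thesis
      by (simp add: M_def abs_mult power_mult_distrib mult.assoc)
  qed
  have slope: "\<bar>picard_slope q a b (Suc n) x\<bar> \<le> M n * d" if x: "x \<in> {0..d}" for n x
  proof -
    have "\<bar>picard_slope q a b (Suc n) x\<bar> \<le> M n * x"
    proof (rule abs_le_of_derivative_bound[where a = 0 and S = "{0..d}"
          and f = "picard_slope q a b (Suc n)" and f' = "picard_curvature q a b (Suc n)"
          and g = "\<lambda>t. M n * t" and g' = "\<lambda>_. M n"])
      fix t assume "t \<in> {0..x}"
      then have t: "t \<in> {0..d}"
        using x by auto
      show "(picard_slope q a b (Suc n) has_real_derivative picard_curvature q a b (Suc n) t) (at t within {0..d})"
        by (rule picard_derivatives[OF q t])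
      show "((\<lambda>t. M n * t) has_real_derivative M n) (at t within {0..d})"
        by (auto intro!: derivative_eq_intros)
      show "\<bar>picard_curvature q a b (Suc n) t\<bar> \<le> M n"
        by (rule curvature[OF t])
    qed (use x in auto)
    also have "\<dots> \<le> M n * d"
      using x M0 by (intro mult_left_mono) auto
    finally show ?thesis .
  qed
  have "uniform_limit {0..d} (\<lambda>n x. \<Sum>i<n. picard_curvature q a b i x)
      (\<lambda>x. \<Sum>i. picard_curvature q a b i x) sequentially"
  proof (rule Weierstrass_m_test)
    show "norm (picard_curvature q a b n x) \<le> (case n of 0 \<Rightarrow> 0 | Suc m \<Rightarrow> M m)" if "x \<in> {0..d}" for n x
      using curvature[OF that] by (cases n) auto
    show "summable (\<lambda>n. case n of 0 \<Rightarrow> 0 | Suc m \<Rightarrow> M m)"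
      using M by (subst summable_Suc_iff[symmetric]) simp
  qed
  then obtain v where v: "\<And>x. x \<in> {0..d} \<Longrightarrow> (\<lambda>n. picard_slope q a b n x) sums v x \<and>
      (v has_real_derivative (\<Sum>i. picard_curvature q a b i x)) (at x within {0..d})"
  proof -
    have "summable (\<lambda>n. picard_slope q a b n 0)"
      by (subst summable_Suc_iff[symmetric]) simp
    then have "\<exists>g. \<forall>x\<in>{0..d}. (\<lambda>n. picard_slope q a b n x) sums g x \<and>
        (g has_real_derivative (\<Sum>i. picard_curvature q a b i x)) (at x within {0..d})"
      using d by (intro has_field_derivative_series[OF _ picard_derivatives(2)[OF q]
          \<open>uniform_limit _ _ _ _\<close>, of 0]) auto
    then show ?thesis
      using that by blast
  qed
  have "uniform_limit {0..d} (\<lambda>n x. \<Sum>i<n. picard_slope q a b i x)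
      (\<lambda>x. \<Sum>i. picard_slope q a b i x) sequentially"
  proof (rule Weierstrass_m_test)
    show "norm (picard_slope q a b n x) \<le> (case n of 0 \<Rightarrow> \<bar>b\<bar> | Suc m \<Rightarrow> M m * d)" if "x \<in> {0..d}" for n x
      using slope[OF that] by (cases n) auto
    show "summable (\<lambda>n. case n of 0 \<Rightarrow> \<bar>b\<bar> | Suc m \<Rightarrow> M m * d)"
      using summable_mult2[OF M, of d] by (subst summable_Suc_iff[symmetric]) simp
  qed
  then obtain u where u: "\<And>x. x \<in> {0..d} \<Longrightarrow> (\<lambda>n. picard_term q a b n x) sums u x \<and>
      (u has_real_derivative (\<Sum>i. picard_slope q a b i x)) (at x within {0..d})"
  proof -
    have "summable (\<lambda>n. picard_term q a b n 0)"
      by (subst summable_Suc_iff[symmetric]) simp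
    then have "\<exists>g. \<forall>x\<in>{0..d}. (\<lambda>n. picard_term q a b n x) sums g x \<and>
        (g has_real_derivative (\<Sum>i. picard_slope q a b i x)) (at x within {0..d})"
      using d by (intro has_field_derivative_series[OF _ picard_derivatives(1)[OF q]
          \<open>uniform_limit _ _ (\<lambda>x. \<Sum>i. picard_slope q a b i x) _\<close>, of 0]) auto
    then show ?thesis
      using that by blast
  qed
  have "schroedinger_solution V d \<mu> u v"
    unfolding schroedinger_solution_iff
  proof
    fix x assume x: "x \<in> {0..d}"
    have "(\<lambda>n. picard_curvature q a b (Suc n) x) sums (q x * u x)"
      using u[OF x] by (auto intro: sums_mult)
    then have "(\<lambda>n. picard_curvature q a b n x) sums (q x * u x)"
      by (subst (asm) sums_Suc_iff) simp
    then have "(\<Sum>i. picard_curvature q a b i x) = q x * u x"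
      by (rule sums_unique[symmetric])
    moreover have "(\<Sum>i. picard_slope q a b i x) = v x"
      using v[OF x] sums_unique by metis
    ultimately show "(u has_real_derivative v x) (at x within {0..d}) \<and>
        (v has_real_derivative (V x - \<mu>) * u x) (at x within {0..d})"
      using u[OF x] v[OF x] by (simp add: q_def)
  qed
  moreover have "u 0 = a"
  proof -
    have "(\<lambda>n. picard_term q a b n 0) sums a"
      using sums_Suc_iff[of "\<lambda>n. picard_term q a b n 0" 0] by simp
    then show ?thesis
      using u[of 0] d sums_unique2 by auto
  qed
  moreover have "v 0 = b"
  proof -
    have "(\<lambda>n. picard_slope q a b n 0) sums b"
      using sums_Suc_iff[of "\<lambda>n. picard_slope q a b n 0" 0] by simp
    then show ?thesis
      using v[of 0] d sums_unique2 by auto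
  qed
  ultimately show ?thesis
    by (rule that)
qed

section \<open>Integration against a monotone weight\<close>

text \<open>If \<open>F' = V g'\<close>, integration by parts gives
  \<open>F b - F a = V b (g b - m) - V a (g a - m) - \<integral> (g - m) dV\<close>, and the Stieltjes integral is nonnegative
  because \<open>g \<ge> m\<close> and \<open>V\<close> is nondecreasing. The proof avoids Stieltjes integrals: with
  \<open>H = V (g - m) - F\<close> the claim is \<open>H a \<le> H b\<close>. On a small interval, freezing \<open>V\<close> at its left
  endpoint costs an error of at most \<open>M\<close> times the increment of \<open>V\<close> times the length. Over \<open>N\<close>
  pieces of equal length the increments of \<open>V\<close> telescope, so the total error is \<open>O(1/N)\<close>.\<close>

lemma monotone_weight_integral_bound:
  fixes V g g' F F' :: "real \<Rightarrow> real"
  assumes "a < b" "{a..b} \<subseteq> S" and V: "mono_on {a..b} V"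
    and g: "\<And>x. x \<in> {a..b} \<Longrightarrow> (g has_real_derivative g' x) (at x within S)"
    and F: "\<And>x. x \<in> {a..b} \<Longrightarrow> (F has_real_derivative F' x) (at x within S)"
    and F': "\<And>x. x \<in> {a..b} \<Longrightarrow> F' x \<le> V x * g' x"
    and M: "\<And>x. x \<in> {a..b} \<Longrightarrow> \<bar>g' x\<bar> \<le> M"
    and m: "\<And>x. x \<in> {a..b} \<Longrightarrow> m \<le> g x"
  shows "F b - F a \<le> V b * g b - V a * g a - m * (V b - V a)"
proof -
  define H where "H x = V x * (g x - m) - F x" for x
  have step: "H x - M * (V y - V x) * (y - x) \<le> H y" if xy: "a \<le> x" "x \<le> y" "y \<le> b" for x y
  proof -
    have sub: "{x..y} \<subseteq> {a..b}" "{x..y} \<subseteq> S"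
      using xy assms(2) by auto
    define c where "c = M * (V y - V x)"
    define G where "G t = c * t + V x * g t - F t" for t
    have "G x \<le> G y"
    proof (rule nondecreasing_within[OF \<open>x \<le> y\<close> sub(2), where f' = "\<lambda>t. c + V x * g' t - F' t"])
      fix t assume "t \<in> {x..y}"
      then have t: "t \<in> {a..b}" using sub by auto
      show "(G has_real_derivative c + V x * g' t - F' t) (at t within S)"
        unfolding G_def by (auto intro!: derivative_eq_intros g[OF t] F[OF t])
    next
      fix t assume t: "x < t" "t < y"
      then have t': "t \<in> {a..b}" "x \<in> {a..b}" "y \<in> {a..b}" using xy by auto
      have "(V t - V x) * g' t \<le> (V t - V x) * M"
        using M[OF t'(1)] mono_onD[OF V t'(2,1)] t by (intro mult_left_mono) auto
      also have "\<dots> \<le> (V y - V x) * M"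
        using M[OF t'(1)] mono_onD[OF V t'(1,3)] t by (intro mult_right_mono) auto
      finally show "0 \<le> c + V x * g' t - F' t"
        using F'[OF t'(1)] by (simp add: c_def algebra_simps)
    qed
    moreover have "0 \<le> (V y - V x) * (g y - m)"
      using xy by (intro mult_nonneg_nonneg) (auto intro: m mono_onD[OF V])
    ultimately show ?thesis
      by (simp add: G_def H_def c_def algebra_simps)
  qed
  \<comment> \<open>The errors of the first \<open>n\<close> pieces add up to at most \<open>M h (V (a + n h) - V a)\<close>.\<close>
  have partition: "H a - M * (V b - V a) * (b - a) / real N \<le> H b" if N: "N > 0" for N :: nat
  proof -
    define h where "h = (b - a) / N"
    have h: "0 \<le> h" "N * h = b - a"
      using \<open>a < b\<close> N by (auto simp: h_def)
    have "H a - M * h * (V (a + n * h) - V a) \<le> H (a + n * h)" if "n \<le> N" for n :: nat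
      using that
    proof (induction n)
      case (Suc n)
      have "(real n + 1) * h \<le> N * h"
        using Suc.prems h by (intro mult_right_mono) auto
      then have "a + (real n + 1) * h \<le> b"
        using h by linarith
      with step[of "a + n * h" "a + (real n + 1) * h"] Suc h
      show ?case
        by (simp add: algebra_simps)
    qed simp
    from this[of N] show ?thesis
      using h by (simp add: h_def field_simps)
  qed
  have "(\<lambda>N. H a - M * (V b - V a) * (b - a) / real N) \<longlonglongrightarrow> H a - 0"
    by (intro tendsto_intros lim_const_over_n)
  then have "H a \<le> H b"
    by (intro LIMSEQ_le_const2) (auto intro!: exI[of _ 1] partition)
  then show ?thesis
    by (simp add: H_def algebra_simps)
qed

section \<open>The lowest level with \<open>u'(0) = 0\<close> and \<open>u(L) = 0\<close>\<close>

locale neumann_family =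
  fixes Q :: "real \<Rightarrow> real" and L :: real and c c' :: "real \<Rightarrow> real \<Rightarrow> real"
  assumes L: "0 < L" and Q: "continuous_on {0..L} Q"
    and sol: "schroedinger_solution Q L \<mu> (c \<mu>) (c' \<mu>)"
    and init: "c \<mu> 0 = 1" "c' \<mu> 0 = 0"
begin

lemmas der = schroedinger_solution_derivatives[OF sol]
lemmas cont = schroedinger_solution_continuous[OF sol]

text \<open>Where \<open>Q - \<mu> \<ge> 0\<close> the product \<open>c c'\<close>, half the derivative of \<open>c\<^sup>2\<close>, has the nonnegative derivative
  \<open>c'\<^sup>2 + (Q - \<mu>) c\<^sup>2\<close>. Hence \<open>c\<^sup>2\<close> never drops below its initial value \<open>1\<close>, and \<open>c\<close> cannot change
  sign.\<close>
lemma positive_below_potential: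
  assumes \<mu>: "\<And>x. x \<in> {0..L} \<Longrightarrow> \<mu> \<le> Q x" and x: "x \<in> {0..L}"
  shows "1 \<le> c \<mu> x" and "0 \<le> c' \<mu> x"
proof -
  have P: "0 \<le> c \<mu> y * c' \<mu> y" if y: "y \<in> {0..L}" for y
  proof -
    have "c \<mu> 0 * c' \<mu> 0 \<le> c \<mu> y * c' \<mu> y"
    proof (rule nondecreasing_within[where x = 0 and y = y and S = "{0..L}"
          and f = "\<lambda>t. c \<mu> t * c' \<mu> t" and f' = "\<lambda>t. (c' \<mu> t)\<^sup>2 + (Q t - \<mu>) * (c \<mu> t)\<^sup>2"])
      fix t assume "t \<in> {0..y}"
      then have t: "t \<in> {0..L}" using y by auto
      show "((\<lambda>t. c \<mu> t * c' \<mu> t) has_real_derivative (c' \<mu> t)\<^sup>2 + (Q t - \<mu>) * (c \<mu> t)\<^sup>2) (at t within {0..L})"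
        by (auto intro!: derivative_eq_intros der[OF t] simp: power2_eq_square)
    qed (use y \<mu> in auto)
    then show ?thesis
      using init by simp
  qed
  have sq: "1 \<le> (c \<mu> y)\<^sup>2" if y: "y \<in> {0..L}" for y
  proof -
    have "(c \<mu> 0)\<^sup>2 \<le> (c \<mu> y)\<^sup>2"
    proof (rule nondecreasing_within[where x = 0 and y = y and S = "{0..L}"
          and f = "\<lambda>t. (c \<mu> t)\<^sup>2" and f' = "\<lambda>t. 2 * (c \<mu> t * c' \<mu> t)"])
      fix t assume "t \<in> {0..y}"
      then have t: "t \<in> {0..L}" using y by auto
      show "((\<lambda>t. (c \<mu> t)\<^sup>2) has_real_derivative 2 * (c \<mu> t * c' \<mu> t)) (at t within {0..L})"
        by (auto intro!: derivative_eq_intros der[OF t])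
    qed (use y P in auto)
    then show ?thesis
      using init by simp
  qed
  show c1: "1 \<le> c \<mu> x"
  proof (rule ccontr)
    assume *: "\<not> 1 \<le> c \<mu> x"
    have "1 \<le> \<bar>c \<mu> x\<bar>"
      using sq[OF x] abs_square_less_1[of "c \<mu> x"] by linarith
    then have "c \<mu> x \<le> 0"
      using * by linarith
    moreover have "continuous_on {0..x} (c \<mu>)"
      using x by (auto intro: continuous_on_subset[OF cont(1)])
    ultimately obtain y where "0 \<le> y" "y \<le> x" "c \<mu> y = 0"
      using IVT2'[of "c \<mu>" x 0 0] init x by auto
    then show False
      using sq[of y] x by auto
  qed
  show "0 \<le> c' \<mu> x"
    using P[OF x] c1 by (simp add: zero_le_mult_iff)
qed

text \<open>Sturm comparison with \<open>cos (\<pi> x / (2 L))\<close>, the corresponding lowest state for a constant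
  potential.\<close>
lemma node_for_large_parameter:
  assumes \<mu>: "\<And>x. x \<in> {0..L} \<Longrightarrow> Q x + (pi / (2 * L))\<^sup>2 \<le> \<mu>"
  shows "\<exists>x\<in>{0..L}. c \<mu> x \<le> 0"
proof (rule ccontr)
  assume "\<not> ?thesis"
  then have pos: "0 < c \<mu> x" if "x \<in> {0..L}" for x
    using that by force
  define \<omega> where "\<omega> = pi / (2 * L)"
  have \<omega>: "0 < \<omega>" "\<omega> * L = pi / 2"
    using L by (auto simp: \<omega>_def)
  \<comment> \<open>The negative of the Wronskian of \<open>c \<mu>\<close> and the cosine.\<close>
  define W where "W x = - (c' \<mu> x * cos (\<omega> * x) + c \<mu> x * (\<omega> * sin (\<omega> * x)))" for x
  have "W 0 \<le> W L"
  proof (rule nondecreasing_within[where x = 0 and y = L and S = "{0..L}" and f = W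
        and f' = "\<lambda>x. (\<mu> - Q x - \<omega>\<^sup>2) * (c \<mu> x * cos (\<omega> * x))"])
    fix x assume x: "x \<in> {0..L}"
    show "(W has_real_derivative (\<mu> - Q x - \<omega>\<^sup>2) * (c \<mu> x * cos (\<omega> * x))) (at x within {0..L})"
      unfolding W_def
      by (auto intro!: derivative_eq_intros der[OF x] simp: algebra_simps power2_eq_square)
  next
    fix x assume x: "0 < x" "x < L"
    have "\<omega> * x < \<omega> * L"
      using \<omega> x by simp
    then have "0 < cos (\<omega> * x)"
      using \<omega> x by (intro cos_gt_zero) auto
    then show "0 \<le> (\<mu> - Q x - \<omega>\<^sup>2) * (c \<mu> x * cos (\<omega> * x))"
      using \<mu>[of x] pos[of x] x by (auto simp: \<omega>_def)
  qed (use L in auto)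
  then have "c \<mu> L * \<omega> \<le> 0"
    using \<omega> init by (simp add: W_def)
  then show False
    using \<omega> pos[of L] L by (simp add: mult_le_0_iff)
qed

lemma continuous_in_parameter:
  assumes "0 < \<epsilon>"
  obtains \<delta> where "0 < \<delta>"
    "\<And>\<mu> x. \<bar>\<mu> - \<mu>\<^sub>0\<bar> < \<delta> \<Longrightarrow> x \<in> {0..L} \<Longrightarrow> \<bar>c \<mu> x - c \<mu>\<^sub>0 x\<bar> < \<epsilon> \<and> \<bar>c' \<mu> x - c' \<mu>\<^sub>0 x\<bar> < \<epsilon>"
proof -
  have "continuous_on {0..L} (\<lambda>x. Q x - \<mu>\<^sub>0)"
    using Q by (intro continuous_intros)
  then obtain K where K: "0 \<le> K" "\<And>x. x \<in> {0..L} \<Longrightarrow> \<bar>Q x - \<mu>\<^sub>0\<bar> \<le> K"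
    using abs_bound_on_interval by blast
  obtain B where B: "0 \<le> B" "\<And>x. x \<in> {0..L} \<Longrightarrow> \<bar>c \<mu>\<^sub>0 x\<bar> \<le> B"
    using abs_bound_on_interval[OF cont(1)] by blast
  \<comment> \<open>\<open>A\<close> becomes a Lipschitz constant for the dependence on the parameter near \<open>\<mu>\<^sub>0\<close>. Bounding
    \<open>\<delta>\<close> by \<open>1\<close> keeps \<open>Q - \<mu>\<close> bounded by \<open>K + 1\<close>.\<close>
  define A where "A = sqrt (exp ((3 + K) * L) * (B\<^sup>2 * L))"
  have A: "0 \<le> A" "A\<^sup>2 = exp ((3 + K) * L) * (B\<^sup>2 * L)"
    using L by (auto simp: A_def)
  define \<delta> where "\<delta> = min 1 (\<epsilon> / (A + 1))"
  have "0 < \<delta>"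
    using assms A by (simp add: \<delta>_def)
  moreover have "\<bar>c \<mu> x - c \<mu>\<^sub>0 x\<bar> < \<epsilon> \<and> \<bar>c' \<mu> x - c' \<mu>\<^sub>0 x\<bar> < \<epsilon>"
    if \<mu>: "\<bar>\<mu> - \<mu>\<^sub>0\<bar> < \<delta>" and x: "x \<in> {0..L}" for \<mu> x
  proof -
    have "(c \<mu> x - c \<mu>\<^sub>0 x)\<^sup>2 + (c' \<mu> x - c' \<mu>\<^sub>0 x)\<^sup>2 \<le>
        exp ((2 + (K + 1)) * (x - 0)) * (((\<mu> - \<mu>\<^sub>0) * B)\<^sup>2 * (x - 0))"
    proof (rule schroedinger_solution_dependence[OF sol sol _ B(2)])
      show "\<bar>Q x - \<mu>\<bar> \<le> K + 1" if "x \<in> {0..L}" for x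
        using K(2)[OF that] \<mu> by (auto simp: \<delta>_def)
    qed (use x init in auto)
    also have "\<dots> \<le> exp ((2 + (K + 1)) * L) * (((\<mu> - \<mu>\<^sub>0) * B)\<^sup>2 * L)"
      using x K(1) by (intro mult_mono) auto
    also have "\<dots> = (A * (\<mu> - \<mu>\<^sub>0))\<^sup>2"
      by (simp add: power_mult_distrib A)
    finally have *: "(c \<mu> x - c \<mu>\<^sub>0 x)\<^sup>2 + (c' \<mu> x - c' \<mu>\<^sub>0 x)\<^sup>2 \<le> (A * (\<mu> - \<mu>\<^sub>0))\<^sup>2" .
    have "\<bar>A * (\<mu> - \<mu>\<^sub>0)\<bar> \<le> A * (\<epsilon> / (A + 1))"
      using \<mu> A(1) unfolding abs_mult by (intro mult_mono) (auto simp: \<delta>_def)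
    also have "\<dots> < \<epsilon>"
      using A(1) assms by (simp add: field_simps)
    finally have "\<bar>A * (\<mu> - \<mu>\<^sub>0)\<bar> < \<epsilon>" .
    moreover have "\<bar>c \<mu> x - c \<mu>\<^sub>0 x\<bar> \<le> \<bar>A * (\<mu> - \<mu>\<^sub>0)\<bar>" "\<bar>c' \<mu> x - c' \<mu>\<^sub>0 x\<bar> \<le> \<bar>A * (\<mu> - \<mu>\<^sub>0)\<bar>"
      using * unfolding abs_le_square_iff by (smt (verit) zero_le_power2)+
    ultimately show ?thesis
      by linarith
  qed
  ultimately show ?thesis
    by (rule that)
qed

lemma neumann_solution_multiple:
  assumes "schroedinger_solution Q L \<mu> u v" "v 0 = 0" "x \<in> {0..L}"
  shows "u x = u 0 * c \<mu> x" and "v x = u 0 * c' \<mu> x"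
  using schroedinger_solution_unique[OF assms(1) sol Q, of 0 "u 0" x] assms(2,3) init L by auto

text \<open>The lowest eigenvalue of the problem \<open>u'(0) = 0 = u(L)\<close>. Taking the infimum over all levels
  with a node anywhere in \<open>[0,L]\<close>, and not just at \<open>L\<close>, makes positivity of \<open>c \<mu>\<close> below it
  immediate.\<close>
definition ground_level :: real where
  "ground_level = Inf {\<mu>. \<exists>x\<in>{0..L}. c \<mu> x \<le> 0}"

lemma bounds_of_potential:
  obtains lo hi where "\<And>x. x \<in> {0..L} \<Longrightarrow> lo \<le> Q x \<and> Q x \<le> hi"
  using abs_bound_on_interval[OF Q] by (metis abs_le_iff minus_le_iff)

lemma positive_below:
  assumes "\<mu> < ground_level" "x \<in> {0..L}"
  shows "0 < c \<mu> x"
proof (rule ccontr)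
  assume "\<not> 0 < c \<mu> x"
  then have in_set: "\<mu> \<in> {\<mu>. \<exists>x\<in>{0..L}. c \<mu> x \<le> 0}"
    using assms(2) by force
  obtain lo hi where "\<And>x. x \<in> {0..L} \<Longrightarrow> lo \<le> Q x \<and> Q x \<le> hi"
    using bounds_of_potential by blast
  then have *: "1 \<le> c \<mu> x" if "\<mu> \<le> lo" "x \<in> {0..L}" for \<mu> x
    using that by (intro positive_below_potential) force+
  have "bdd_below {\<mu>. \<exists>x\<in>{0..L}. c \<mu> x \<le> 0}"
  proof (rule bdd_belowI[of _ lo])
    fix \<mu> assume "\<mu> \<in> {\<mu>. \<exists>x\<in>{0..L}. c \<mu> x \<le> 0}"
    then show "lo \<le> \<mu>"
      using *[of \<mu>] by force
  qed
  then have "ground_level \<le> \<mu>"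
    unfolding ground_level_def by (rule cInf_lower[OF in_set])
  then show False
    using assms(1) by simp
qed

text \<open>A solution that is positive on the compact interval stays positive under small changes of the
  parameter, so the infimum is attained.\<close>
lemma node_at_ground_level: "\<exists>x\<in>{0..L}. c ground_level x \<le> 0"
proof (rule ccontr)
  assume "\<not> ?thesis"
  then have pos: "0 < c ground_level x" if "x \<in> {0..L}" for x
    using that by force
  obtain z where z: "z \<in> {0..L}" "\<And>x. x \<in> {0..L} \<Longrightarrow> c ground_level z \<le> c ground_level x"
    using continuous_attains_inf[OF _ _ cont(1), of ground_level] L by auto
  obtain \<delta> where \<delta>: "0 < \<delta>"
    "\<And>\<mu> x. \<bar>\<mu> - ground_level\<bar> < \<delta> \<Longrightarrow> x \<in> {0..L} \<Longrightarrow> \<bar>c \<mu> x - c ground_level x\<bar> < c ground_level z \<and> \<bar>c' \<mu> x - c' ground_level x\<bar> < c ground_level z"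
    using continuous_in_parameter[OF pos[OF z(1)], of ground_level] by metis
  have "ground_level + \<delta> \<le> \<mu>" if \<mu>: "\<exists>x\<in>{0..L}. c \<mu> x \<le> 0" for \<mu>
  proof (rule ccontr)
    assume *: "\<not> ground_level + \<delta> \<le> \<mu>"
    obtain x where x: "x \<in> {0..L}" "c \<mu> x \<le> 0"
      using \<mu> by auto
    have "ground_level \<le> \<mu>"
      using positive_below[of \<mu>, OF _ x(1)] x(2) by linarith
    then have "\<bar>c \<mu> x - c ground_level x\<bar> < c ground_level z"
      using \<delta>(2)[OF _ x(1)] * by auto
    then show False
      using z(2)[OF x(1)] x(2) by linarith
  qed
  moreover have "{\<mu>. \<exists>x\<in>{0..L}. c \<mu> x \<le> 0} \<noteq> {}"
  proof -
    obtain lo hi where "\<And>x. x \<in> {0..L} \<Longrightarrow> lo \<le> Q x \<and> Q x \<le> hi"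
      using bounds_of_potential by blast
    then have "\<exists>x\<in>{0..L}. c (hi + (pi / (2 * L))\<^sup>2) x \<le> 0"
      by (intro node_for_large_parameter) auto
    then show ?thesis by blast
  qed
  ultimately have "ground_level + \<delta> \<le> ground_level"
    unfolding ground_level_def by (intro cInf_greatest) auto
  then show False
    using \<delta>(1) by simp
qed

text \<open>A negative value would persist for parameters slightly below the ground level, where the
  solution is positive.\<close>
lemma nonnegative_at_ground_level:
  assumes "x \<in> {0..L}"
  shows "0 \<le> c ground_level x"
proof (rule ccontr)
  assume "\<not> 0 \<le> c ground_level x"
  then have neg: "0 < - c ground_level x" by simp
  obtain \<delta> where \<delta>: "0 < \<delta>"
    "\<And>\<mu> y. \<bar>\<mu> - ground_level\<bar> < \<delta> \<Longrightarrow> y \<in> {0..L} \<Longrightarrow> \<bar>c \<mu> y - c ground_level y\<bar> < - c ground_level x \<and> \<bar>c' \<mu> y - c' ground_level y\<bar> < - c ground_level x"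
    using continuous_in_parameter[OF neg, of ground_level] by metis
  have "\<bar>c (ground_level - \<delta> / 2) x - c ground_level x\<bar> < - c ground_level x"
    using \<delta>(2)[OF _ assms, of "ground_level - \<delta> / 2"] \<delta>(1) by simp
  moreover have "0 < c (ground_level - \<delta> / 2) x"
    using \<delta>(1) assms by (intro positive_below) auto
  ultimately show False by linarith
qed

lemma no_double_zero:
  assumes "x \<in> {0..L}" "c \<mu> x = 0"
  shows "c' \<mu> x \<noteq> 0"
  using schroedinger_solution_eq_zero[OF sol Q assms(1), of \<mu> 0] assms(2) init L by auto

text \<open>The zero that exists at the ground level cannot lie in the interior: it would be a minimum of a
  nonnegative function, hence a double zero. It cannot be a double zero at \<open>L\<close> either, so the
  derivative there is strictly negative.\<close>
lemma ground_state:
  shows "\<And>x. 0 \<le> x \<Longrightarrow> x < L \<Longrightarrow> 0 < c ground_level x" and "c ground_level L = 0" and "c' ground_level L < 0"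
proof -
  have zero: "x = L" if x: "x \<in> {0..L}" "c ground_level x = 0" for x
  proof (rule ccontr)
    assume "x \<noteq> L"
    moreover have "x \<noteq> 0"
      using x init by auto
    ultimately have x': "0 < x" "x < L"
      using x by auto
    have "(c ground_level has_real_derivative c' ground_level x) (at x)"
      using der(1)[OF x(1)] x' by (simp add: at_within_Icc_at)
    then have "c' ground_level x = 0"
    proof (rule DERIV_local_min[where d = "min x (L - x)"])
      show "\<forall>y. \<bar>x - y\<bar> < min x (L - x) \<longrightarrow> c ground_level x \<le> c ground_level y"
        using x(2) by (auto intro!: nonnegative_at_ground_level)
    qed (use x' in auto)
    then show False
      using no_double_zero[OF x] by simp
  qed
  obtain z where z: "z \<in> {0..L}" "c ground_level z \<le> 0"
    using node_at_ground_level by blast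
  then have "c ground_level z = 0"
    using nonnegative_at_ground_level[OF z(1)] by simp
  then show L0: "c ground_level L = 0"
    using zero[OF z(1)] by simp
  show "0 < c ground_level x" if "0 \<le> x" "x < L" for x
    using nonnegative_at_ground_level[of x] zero[of x] that by force
  show "c' ground_level L < 0"
  proof (rule ccontr)
    assume "\<not> c' ground_level L < 0"
    then have "0 < c' ground_level L"
      using no_double_zero[OF _ L0] L by force
    then obtain e where e: "0 < e" "\<And>h. 0 < h \<Longrightarrow> L - h \<in> {0..L} \<Longrightarrow> h < e \<Longrightarrow> c ground_level (L - h) < c ground_level L"
      using has_real_derivative_pos_inc_left[OF der(1)[of L ground_level]] L by auto
    have "c ground_level (L - min (e/2) L) < 0"
      using e(2)[of "min (e/2) L"] e(1) L L0 by auto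
    then show False
      using nonnegative_at_ground_level[of "L - min (e/2) L"] e(1) L by auto
  qed
qed

text \<open>The end slope \<open>c'(L)\<close> is nonnegative when \<open>\<mu>\<close> lies below the potential and negative at the ground
  level, and it depends continuously on \<open>\<mu>\<close>.\<close>
lemma critical_level_exists:
  obtains \<alpha> where "\<alpha> < ground_level" "c' \<alpha> L = 0"
proof -
  obtain lo hi where lo: "\<And>x. x \<in> {0..L} \<Longrightarrow> lo \<le> Q x \<and> Q x \<le> hi"
    using bounds_of_potential by blast
  have "0 \<le> c' lo L"
    using lo L by (intro positive_below_potential) auto
  moreover have "lo \<le> ground_level"
  proof (rule ccontr)
    assume "\<not> lo \<le> ground_level"
    then have "1 \<le> c ground_level L"
      using lo L by (intro positive_below_potential) force+
    then show False
      using ground_state(2) by simp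
  qed
  moreover have "continuous_on {lo..ground_level} (\<lambda>\<mu>. c' \<mu> L)"
    unfolding continuous_on_iff dist_real_def
  proof (intro ballI allI impI)
    fix \<mu>\<^sub>0 \<epsilon> :: real assume "0 < \<epsilon>"
    from continuous_in_parameter[OF this, of \<mu>\<^sub>0]
    show "\<exists>\<delta>>0. \<forall>\<mu>\<in>{lo..ground_level}. \<bar>\<mu> - \<mu>\<^sub>0\<bar> < \<delta> \<longrightarrow> \<bar>c' \<mu> L - c' \<mu>\<^sub>0 L\<bar> < \<epsilon>"
      using L by (metis atLeastAtMost_iff less_imp_le order_refl)
  qed
  ultimately obtain \<alpha> where "lo \<le> \<alpha>" "\<alpha> \<le> ground_level" "c' \<alpha> L = 0"
    using IVT2'[of "\<lambda>\<mu>. c' \<mu> L" ground_level 0 lo] ground_state(3) by auto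
  moreover have "\<alpha> \<noteq> ground_level"
    using calculation(3) ground_state(3) by auto
  ultimately show ?thesis
    by (intro that) auto
qed

text \<open>For two such levels the Wronskian would vanish at both ends, but it is strictly monotone in
  between because both solutions are positive.\<close>
lemma critical_level_unique:
  assumes "\<mu> < ground_level" "\<mu>' < ground_level" "c' \<mu> L = 0" "c' \<mu>' L = 0"
  shows "\<mu> = \<mu>'"
proof -
  have no: False if "\<mu> < \<mu>'" "\<mu>' < ground_level" "c' \<mu> L = 0" "c' \<mu>' L = 0" for \<mu> \<mu>'
  proof -
    have "c' \<mu> 0 * c \<mu>' 0 - c \<mu> 0 * c' \<mu>' 0 < c' \<mu> L * c \<mu>' L - c \<mu> L * c' \<mu>' L"
    proof (rule strictly_increasing_within[OF L order_refl])
      show "((\<lambda>x. c' \<mu> x * c \<mu>' x - c \<mu> x * c' \<mu>' x) has_real_derivative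
          (\<mu>' - \<mu>) * (c \<mu> x * c \<mu>' x)) (at x within {0..L})" if "x \<in> {0..L}" for x
        using that by (rule wronskian_derivative[OF sol sol])
      show "0 < (\<mu>' - \<mu>) * (c \<mu> x * c \<mu>' x)" if "0 < x" "x < L" for x
        using that \<open>\<mu> < \<mu>'\<close> \<open>\<mu>' < ground_level\<close> by (intro mult_pos_pos positive_below) auto
    qed
    then show False
      using that init by simp
  qed
  show ?thesis
    using no[of \<mu> \<mu>'] no[of \<mu>' \<mu>] assms by (cases \<mu> \<mu>' rule: linorder_cases) auto
qed

text \<open>The sign of \<open>c'' = (Q - ground_level) c\<close> changes at most once, from negative to positive. To the left of
  any point with \<open>Q < ground_level\<close> the slope decreases from \<open>0\<close>; to the right of any other point it increases
  to its negative final value. In both cases it is negative at that point.\<close>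
lemma ground_state_decreasing:
  assumes mono: "mono_on {0..L} Q" and x: "0 < x" "x \<le> L"
  shows "c' ground_level x < 0"
proof (rule ccontr)
  assume neg: "\<not> c' ground_level x < 0"
  show False
  proof (cases "Q x < ground_level")
    case True
    have "- c' ground_level 0 < - c' ground_level x"
    proof (rule strictly_increasing_within[OF x(1), where S = "{0..L}" and f' = "\<lambda>t. - ((Q t - ground_level) * c ground_level t)"])
      show "((\<lambda>t. - c' ground_level t) has_real_derivative - ((Q t - ground_level) * c ground_level t)) (at t within {0..L})"
        if "t \<in> {0..x}" for t
        using that x by (intro DERIV_minus der) auto
      show "0 < - ((Q t - ground_level) * c ground_level t)" if "0 < t" "t < x" for t
      proof -
        have "Q t \<le> Q x"
          using that x by (intro mono_onD[OF mono]) auto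
        then show ?thesis
          using True ground_state(1)[of t] that x by (simp add: mult_neg_pos)
      qed
    qed (use x in auto)
    then show False
      using neg init by simp
  next
    case False
    have "c' ground_level x \<le> c' ground_level L"
    proof (rule nondecreasing_within[OF x(2), where S = "{0..L}" and f' = "\<lambda>t. (Q t - ground_level) * c ground_level t"])
      show "(c' ground_level has_real_derivative (Q t - ground_level) * c ground_level t) (at t within {0..L})" if "t \<in> {x..L}" for t
        using that x by (intro der) auto
      show "0 \<le> (Q t - ground_level) * c ground_level t" if "x < t" "t < L" for t
      proof -
        have "Q x \<le> Q t"
          using that x by (intro mono_onD[OF mono]) auto
        then show ?thesis
          using False ground_state(1)[of t] that x by simp
      qed
    qed (use x in auto)
    then show False
      using neg ground_state(3) by simp
  qed
qed

text \<open>The heart of the comparison: integrate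
  \<open>(c' w')' = (Q - ground_level) (c w)' + (ground_level - \<mu>) c' w\<close> over \<open>[0,L]\<close>. The left side gives \<open>0\<close>, the
  first term on the right is negative because \<open>c w\<close> vanishes at the ends, is positive between
  them and \<open>Q\<close> increases, and \<open>c' w \<le> 0\<close>. So \<open>\<mu> \<le> ground_level\<close> is impossible.\<close>
lemma ground_level_less_mixed_eigenvalue:
  assumes Q_incr: "strict_mono_on {0..L} Q"
    and w: "schroedinger_solution Q L \<mu> w w'" "w 0 = 0" "w' L = 0"
    and w_pos: "\<And>x. 0 < x \<Longrightarrow> x < L \<Longrightarrow> 0 < w x"
  shows "ground_level < \<mu>"
proof (rule ccontr)
  assume "\<not> ground_level < \<mu>"
  then have le: "\<mu> \<le> ground_level" by simp
  have mono: "mono_on {0..L} Q"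
    using Q_incr by (rule strict_mono_on_imp_mono_on)
  define V where "V x = Q x - ground_level" for x
  define F where "F x = c' ground_level x * w' x" for x
  define F' where "F' x = (Q x - ground_level) * c ground_level x * w' x + c' ground_level x * ((Q x - \<mu>) * w x)" for x
  define g where "g x = c ground_level x * w x" for x
  define g' where "g' x = c' ground_level x * w x + c ground_level x * w' x" for x
  have F: "(F has_real_derivative F' x) (at x within {0..L})" if x: "x \<in> {0..L}" for x
    unfolding F_def F'_def
    by (auto intro!: derivative_eq_intros der[OF x] schroedinger_solution_derivatives[OF w(1) x] simp: algebra_simps)
  have g: "(g has_real_derivative g' x) (at x within {0..L})" if x: "x \<in> {0..L}" for x
    unfolding g_def g'_def
    by (auto intro!: derivative_eq_intros der[OF x] schroedinger_solution_derivatives[OF w(1) x] simp: algebra_simps)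
  have "continuous_on {0..L} g'"
    unfolding g'_def by (intro continuous_intros cont schroedinger_solution_continuous[OF w(1)])
  then obtain M where M: "\<And>x. x \<in> {0..L} \<Longrightarrow> \<bar>g' x\<bar> \<le> M"
    using abs_bound_on_interval by blast
  \<comment> \<open>At \<open>L\<close> no sign of \<open>w\<close> is given, but it follows by continuity.\<close>
  have w_nonneg: "0 \<le> w x" if "x \<in> {0..L}" for x
  proof (cases "x = L")
    case True
    have "continuous_on {0..L} w"
      by (rule schroedinger_solution_continuous[OF w(1)])
    then show ?thesis
      using continuous_ge_on_closure[of "{0<..<L}" w x 0] w_pos L True by (force simp: less_imp_le)
  next
    case False
    then show ?thesis
      using w_pos[of x] w(2) that by (cases "x = 0") auto
  qed
  have c'_nonpos: "c' ground_level x \<le> 0" if "x \<in> {0..L}" for x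
    using ground_state_decreasing[OF mono, of x] init that by (cases "x = 0") auto
  have F': "F' x \<le> V x * g' x" if x: "x \<in> {0..L}" for x
  proof -
    have "(ground_level - \<mu>) * (c' ground_level x * w x) \<le> 0"
      using le c'_nonpos[OF x] w_nonneg[OF x] by (intro mult_nonneg_nonpos mult_nonpos_nonneg) auto
    then show ?thesis
      by (simp add: F'_def V_def g'_def algebra_simps)
  qed
  have g_nonneg: "0 \<le> g x" if "x \<in> {0..L}" for x
    using nonnegative_at_ground_level w_nonneg that by (simp add: g_def)
  have estimate: "F b - F a \<le> V b * g b - V a * g a - m * (V b - V a)"
    if "0 \<le> a" "a < b" "b \<le> L" "\<And>x. x \<in> {a..b} \<Longrightarrow> m \<le> g x" for a b m
  proof -
    have sub: "{a..b} \<subseteq> {0..L}" using that by auto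
    have "mono_on {a..b} V"
      using mono_on_subset[OF mono sub] by (auto simp: V_def monotone_on_def)
    then show ?thesis
      using that sub by (intro monotone_weight_integral_bound[where S = "{0..L}" and M = M and F' = F' and g' = g'] F F' g M) auto
  qed
  \<comment> \<open>Strictness comes from the middle third, where \<open>g\<close> is bounded away from \<open>0\<close>; on the outer
    thirds the lower bound \<open>m = 0\<close> is enough.\<close>
  obtain z where z: "z \<in> {L/3..2*L/3}" "\<And>x. x \<in> {L/3..2*L/3} \<Longrightarrow> g z \<le> g x"
  proof -
    have "continuous_on {L/3..2*L/3} g"
      by (rule continuous_on_subset[OF DERIV_continuous_on[OF g]]) (use L in auto)
    then show ?thesis
      using continuous_attains_inf[of "{L/3..2*L/3}" g] that L by auto
  qed
  have "0 < g z"
    using z(1) L ground_state(1)[of z] w_pos[of z] by (simp add: g_def)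
  moreover have "V (L/3) < V (2*L/3)"
    using strict_mono_onD[OF Q_incr, of "L/3" "2*L/3"] L by (simp add: V_def)
  ultimately have "0 < g z * (V (2*L/3) - V (L/3))"
    by simp
  moreover have "F (L/3) - F 0 \<le> V (L/3) * g (L/3) - V 0 * g 0 - 0 * (V (L/3) - V 0)"
    using L g_nonneg by (intro estimate) auto
  moreover have "F (2*L/3) - F (L/3) \<le> V (2*L/3) * g (2*L/3) - V (L/3) * g (L/3) - g z * (V (2*L/3) - V (L/3))"
    using L z(2) by (intro estimate) auto
  moreover have "F L - F (2*L/3) \<le> V L * g L - V (2*L/3) * g (2*L/3) - 0 * (V L - V (2*L/3))"
    using L g_nonneg by (intro estimate) auto
  moreover have "F 0 = 0" "F L = 0" "g 0 = 0" "g L = 0"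
    using init w ground_state(2) by (auto simp: F_def g_def)
  ultimately show False
    by simp
qed

end

section \<open>Spectra of a potential symmetric about the midpoint\<close>

lemma kth_smallestI:
  assumes "x \<in> S" "finite {y \<in> S. y < x}" "card {y \<in> S. y < x} + 1 = k"
  shows "kth_smallest S k = x"
  unfolding kth_smallest_def
proof (rule the_equality)
  have less: False if "x < x'" "x \<in> S" "finite {y \<in> S. y < x'}"
    "card {y \<in> S. y < x'} = card {y \<in> S. y < x}" for x x' :: real
  proof -
    have "{y \<in> S. y < x} \<subset> {y \<in> S. y < x'}"
      using that by auto
    then show False
      using psubset_card_mono[OF that(3), of "{y \<in> S. y < x}"] that(4) by simp
  qed
  fix x' assume "x' \<in> S \<and> finite {y \<in> S. y < x'} \<and> card {y \<in> S. y < x'} + 1 = k"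
  then show "x' = x"
    using less[of x x'] less[of x' x] assms by (cases x x' rule: linorder_cases) simp_all
qed (use assms in auto)

text \<open>The Wronskian of \<open>u\<close> with its reflection, evaluated at \<open>0\<close> and at the midpoint. When a nontrivial
  \<open>u\<close> satisfies a Dirichlet or Neumann condition at \<open>0\<close>, the same condition at \<open>d\<close> therefore holds exactly
  when \<open>u\<close> or \<open>u'\<close> vanishes at the midpoint.\<close>
lemma symmetric_potential_midpoint_identity:
  assumes u: "schroedinger_solution V d \<mu> u v" and d: "0 \<le> d"
    and sym: "\<And>x. x \<in> {0..d} \<Longrightarrow> V (d - x) = V x"
  shows "v 0 * u d + u 0 * v d = 2 * u (d / 2) * v (d / 2)"
proof -
  have "schroedinger_solution V d \<mu> (\<lambda>x. u (d - x)) (\<lambda>x. - v (d - x))"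
    using u by (rule schroedinger_solution_reflect) (simp add: sym)
  from wronskian_constant[OF u this, of 0 "d / 2"] show ?thesis
    using d by simp
qed

text \<open>The reflected solution and \<open>- u\<close> have the same data at the midpoint.\<close>
lemma symmetric_potential_odd:
  assumes u: "schroedinger_solution V d \<mu> u v" and d: "0 \<le> d" and V: "continuous_on {0..d} V"
    and sym: "\<And>x. x \<in> {0..d} \<Longrightarrow> V (d - x) = V x"
    and zero: "u (d / 2) = 0" and x: "x \<in> {0..d}"
  shows "u (d - x) = - u x" and "v (d - x) = v x"
proof -
  have "schroedinger_solution V d \<mu> (\<lambda>x. u (d - x)) (\<lambda>x. - v (d - x))"
    using u by (rule schroedinger_solution_reflect) (simp add: sym)
  from schroedinger_solution_unique[OF this u V, of "d / 2" "-1" x]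
  show "u (d - x) = - u x" and "v (d - x) = v x"
    using zero d x by auto
qed

lemma symmetric_potential_even:
  assumes u: "schroedinger_solution V d \<mu> u v" and d: "0 \<le> d" and V: "continuous_on {0..d} V"
    and sym: "\<And>x. x \<in> {0..d} \<Longrightarrow> V (d - x) = V x"
    and zero: "v (d / 2) = 0" and x: "x \<in> {0..d}"
  shows "u (d - x) = u x"
proof -
  have "schroedinger_solution V d \<mu> (\<lambda>x. u (d - x)) (\<lambda>x. - v (d - x))"
    using u by (rule schroedinger_solution_reflect) (simp add: sym)
  from schroedinger_solution_unique(1)[OF this u V, of "d / 2" 1 x]
  show ?thesis
    using zero d x by auto
qed

text \<open>Eigenvalues on \<open>[0,d]\<close> are expressed below through the ground levels on \<open>[0,d/2]\<close> of \<open>V\<close> (for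
  Neumann conditions) and of its reflection \<open>V (d/2 - x)\<close> (for Dirichlet conditions).\<close>
locale symmetric_potential =
  fixes V :: "real \<Rightarrow> real" and d :: real
  assumes d: "0 < d" and V: "continuous_on {0..d} V"
    and sym: "\<And>x. x \<in> {0..d} \<Longrightarrow> V (d - x) = V x"
begin

lemma solution_on_half:
  assumes "schroedinger_solution V d \<mu> u v"
  shows "schroedinger_solution V (d / 2) \<mu> u v"
    and "schroedinger_solution (\<lambda>x. V (d / 2 - x)) (d / 2) \<mu> (\<lambda>x. u (d / 2 - x)) (\<lambda>x. - v (d / 2 - x))"
proof -
  show *: "schroedinger_solution V (d / 2) \<mu> u v"
    using assms by (rule schroedinger_solution_restrict) (use d in simp)
  show "schroedinger_solution (\<lambda>x. V (d / 2 - x)) (d / 2) \<mu> (\<lambda>x. u (d / 2 - x)) (\<lambda>x. - v (d / 2 - x))"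
    by (rule schroedinger_solution_reflect[OF *]) simp
qed

text \<open>Below the ground level \<open>c \<mu>\<close> does not vanish at the midpoint, so a Neumann eigenvalue there forces a
  vanishing midpoint slope, and this happens for exactly one \<open>\<mu>\<close>.\<close>
lemma neumann_eigenvalue_2_eq:
  assumes full: "\<And>\<mu>. schroedinger_solution V d \<mu> (c \<mu>) (c' \<mu>)"
    and half: "neumann_family V (d / 2) c c'"
  shows "neumann_eigenvalue V d 2 = neumann_family.ground_level (d / 2) c"
proof -
  interpret neumann_family V "d / 2" c c' by (rule half)
  obtain \<alpha> where \<alpha>: "\<alpha> < ground_level" "c' \<alpha> (d / 2) = 0"
    by (rule critical_level_exists)
  let ?S = "{\<mu>. \<exists>u. neumann_eigenfunction V d \<mu> u}"
  have in_S: "\<mu> \<in> ?S" if "c \<mu> (d / 2) * c' \<mu> (d / 2) = 0" for \<mu>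
  proof -
    have "c' \<mu> d = 0"
      using symmetric_potential_midpoint_identity[OF full _ sym, of \<mu>] that d init by auto
    moreover have "\<exists>x\<in>{0..d}. c \<mu> x \<noteq> 0"
      using d init by (intro bexI[of _ 0]) auto
    ultimately have "neumann_eigenfunction V d \<mu> (c \<mu>)"
      using full init unfolding neumann_eigenfunction_def by blast
    then show ?thesis by blast
  qed
  have below: "\<mu> = \<alpha>" if \<mu>: "\<mu> < ground_level" "\<mu> \<in> ?S" for \<mu>
  proof -
    obtain u where "neumann_eigenfunction V d \<mu> u"
      using \<mu>(2) by blast
    then obtain v where v: "\<exists>x\<in>{0..d}. u x \<noteq> 0" "schroedinger_solution V d \<mu> u v" "v 0 = 0" "v d = 0"
      unfolding neumann_eigenfunction_def by blast
    have "u 0 \<noteq> 0"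
      using schroedinger_solution_nontrivial[OF v(2) V v(1), of 0] v(3) d by simp
    have mid: "u (d / 2) = u 0 * c \<mu> (d / 2)" "v (d / 2) = u 0 * c' \<mu> (d / 2)"
      using neumann_solution_multiple[OF solution_on_half(1)[OF v(2)] v(3), of "d / 2"] d by simp_all
    have "u (d / 2) * v (d / 2) = 0"
      using symmetric_potential_midpoint_identity[OF v(2) _ sym] v d by simp
    moreover have "0 < c \<mu> (d / 2)"
      using positive_below[OF \<mu>(1)] d by simp
    ultimately have "c' \<mu> (d / 2) = 0"
      using \<open>u 0 \<noteq> 0\<close> mid by simp
    then show ?thesis
      using critical_level_unique[OF \<mu>(1) \<alpha>(1)] \<alpha>(2) by simp
  qed
  have "\<alpha> \<in> ?S" "ground_level \<in> ?S"
    using \<alpha> ground_state(2) by (auto intro!: in_S simp del: mem_Collect_eq)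
  moreover have "{\<mu> \<in> ?S. \<mu> < ground_level} = {\<alpha>}"
    using below \<alpha>(1) \<open>\<alpha> \<in> ?S\<close> by blast
  ultimately show ?thesis
    unfolding neumann_eigenvalue_def by (intro kth_smallestI) simp_all
qed

lemma neumann_eigenfunction_2:
  assumes half: "neumann_family V (d / 2) c c'"
    and incr: "mono_on {0..d/2} V"
    and u: "neumann_eigenfunction V d (neumann_family.ground_level (d / 2) c) u"
  shows "strictly_monotone_on {0..d} u" and "odd_about_midpoint d u"
proof -
  interpret neumann_family V "d / 2" c c' by (rule half)
  obtain v where v: "\<exists>x\<in>{0..d}. u x \<noteq> 0" "schroedinger_solution V d ground_level u v" "v 0 = 0" "v d = 0"
    using u unfolding neumann_eigenfunction_def by blast
  have u0: "u 0 \<noteq> 0"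
    using schroedinger_solution_nontrivial[OF v(2) V v(1), of 0] v(3) d by simp
  note multiple = neumann_solution_multiple[OF solution_on_half(1)[OF v(2)] v(3)]
  have "u (d / 2) = 0"
    using multiple(1)[of "d / 2"] ground_state(2) d by simp
  note odd = symmetric_potential_odd[OF v(2) less_imp_le[OF d] V sym this]
  show "odd_about_midpoint d u"
    using odd(1) by (simp add: odd_about_midpoint_def)
  have left: "0 < - u 0 * v x" if x: "0 < x" "x \<le> d / 2" for x
  proof -
    have "0 < (u 0)\<^sup>2 * - c' ground_level x"
      using u0 ground_state_decreasing[OF incr x] by (intro mult_pos_pos) auto
    then show ?thesis
      using multiple(2)[of x] x by (simp add: power2_eq_square)
  qed
  show "strictly_monotone_on {0..d} u"
  proof (rule strictly_monotone_on_if_derivative_sign[OF order_refl])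
    show "(u has_real_derivative v x) (at x within {0..d})" if "x \<in> {0..d}" for x
      using schroedinger_solution_derivatives(1)[OF v(2) that] .
    show "0 < - u 0 * v x" if x: "0 < x" "x < d" for x
    proof (cases "x \<le> d / 2")
      case True
      then show ?thesis using left x by blast
    next
      case False
      then have "0 < - u 0 * v (d - x)"
        using x by (intro left) auto
      then show ?thesis
        using odd(2)[of x] x by simp
    qed
  qed
qed

text \<open>With \<open>f x = u (d/2 - x)\<close>, the midpoint identity gives \<open>f 0 = 0\<close> or \<open>f' 0 = 0\<close>, and \<open>f (d/2) = 0\<close>. The
  first alternative would put two zeros of \<open>f / e \<mu>\<close> into an interval where this quotient is
  monotone, or, at the ground level, make the Wronskian vanish; either way \<open>u\<close> would be trivial.
  In the second alternative \<open>f\<close> is a multiple of \<open>e \<mu>\<close>, which has a zero at \<open>d/2\<close> only at the ground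
  level.\<close>
lemma dirichlet_solution_below:
  assumes half: "neumann_family (\<lambda>x. V (d / 2 - x)) (d / 2) e e'"
    and u: "schroedinger_solution V d \<mu> u v" "u 0 = 0" "u d = 0" "\<exists>x\<in>{0..d}. u x \<noteq> 0"
    and le: "\<mu> \<le> neumann_family.ground_level (d / 2) e"
  shows "v (d / 2) = 0" and "u (d / 2) \<noteq> 0" and "\<mu> = neumann_family.ground_level (d / 2) e"
proof -
  interpret neumann_family "\<lambda>x. V (d / 2 - x)" "d / 2" e e' by (rule half)
  define f where "f x = u (d / 2 - x)" for x
  define f' where "f' x = - v (d / 2 - x)" for x
  have f: "schroedinger_solution (\<lambda>x. V (d / 2 - x)) (d / 2) \<mu> f f'"
    unfolding f_def f'_def by (rule solution_on_half(2)[OF u(1)])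
  have fL: "f (d / 2) = 0"
    using u(2) by (simp add: f_def)
  have not_both: "u (d / 2) \<noteq> 0 \<or> v (d / 2) \<noteq> 0"
    using schroedinger_solution_nontrivial[OF u(1) V u(4), of "d / 2"] d by simp
  have prod: "u (d / 2) * v (d / 2) = 0"
    using symmetric_potential_midpoint_identity[OF u(1) _ sym] u d by simp
  have W: "f' x * e \<mu> x - f x * e' \<mu> x = f' 0 - f 0 * e' \<mu> 0" if "x \<in> {0..d/2}" for x
    using wronskian_constant[OF f sol that, of 0] d init by simp
  show uL: "u (d / 2) \<noteq> 0"
  proof
    assume "u (d / 2) = 0"
    then have f0: "f 0 = 0" by (simp add: f_def)
    have "f' 0 = 0"
    proof (cases "\<mu> < ground_level")
      case True
      have pos: "0 < e \<mu> x" if "x \<in> {0..d/2}" for x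
        using positive_below[OF True that] .
      have D: "((\<lambda>x. f x / e \<mu> x) has_real_derivative f' 0 / (e \<mu> x)\<^sup>2) (at x within {0..d/2})"
        if x: "x \<in> {0..d/2}" for x
        using DERIV_divide[OF schroedinger_solution_derivatives(1)[OF f x] der(1)[OF x, of \<mu>]] W[OF x] pos[OF x] f0
        by (simp add: power2_eq_square)
      have d2: "0 < d / 2" using d by simp
      obtain t where t: "0 < t" "t < d / 2"
        "f (d / 2) / e \<mu> (d / 2) - f 0 / e \<mu> 0 = f' 0 / (e \<mu> t)\<^sup>2 * (d / 2 - 0)"
        by (rule mean_value_within[OF d2 order_refl D])
      then show ?thesis
        using fL f0 d pos[of t] by simp
    next
      case False
      then have "\<mu> = ground_level" using le by simp
      then show ?thesis
        using W[of "d / 2"] fL f0 ground_state(2) d by simp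
    qed
    then show False
      using \<open>u (d / 2) = 0\<close> not_both by (simp add: f'_def)
  qed
  show vL: "v (d / 2) = 0"
    using prod uL by simp
  show "\<mu> = ground_level"
  proof (rule ccontr)
    assume "\<mu> \<noteq> ground_level"
    then have "0 < e \<mu> (d / 2)"
      using le d by (intro positive_below) auto
    moreover have "f (d / 2) = f 0 * e \<mu> (d / 2)"
      using vL d by (intro neumann_solution_multiple[OF f]) (auto simp: f'_def)
    ultimately show False
      using fL uL by (simp add: f_def)
  qed
qed

text \<open>At the ground level of the reflected potential, the solution that starts at \<open>0\<close> with slope \<open>1\<close> has a
  critical point at the midpoint: its reflection and the ground state both vanish at the far end, so
  their Wronskian is zero. Hence it is a Dirichlet eigenfunction, and no lower level has one.\<close>
lemma dirichlet_eigenvalue_1_eq: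
  assumes half: "neumann_family (\<lambda>x. V (d / 2 - x)) (d / 2) e e'"
  shows "dirichlet_eigenvalue V d 1 = neumann_family.ground_level (d / 2) e"
proof -
  interpret neumann_family "\<lambda>x. V (d / 2 - x)" "d / 2" e e' by (rule half)
  obtain s s' where s: "schroedinger_solution V d ground_level s s'" "s 0 = 0" "s' 0 = 1"
    using schroedinger_solution_exists[OF V, of ground_level 0 1] d by auto
  have mid: "s' (d / 2) = 0"
    using wronskian_constant[OF solution_on_half(2)[OF s(1)] sol[of ground_level], of 0 "d / 2"]
      ground_state(2) s init d by simp
  have "s d = 0"
    using symmetric_potential_midpoint_identity[OF s(1) _ sym] mid s d by simp
  moreover have "s (d / 2) \<noteq> 0"
    using schroedinger_solution_eq_zero[OF s(1) V _ _ mid, of 0] s(3) d by force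
  then have "\<exists>x\<in>{0..d}. s x \<noteq> 0"
    using d by (intro bexI[of _ "d / 2"]) auto
  ultimately have "dirichlet_eigenfunction V d ground_level s"
    using s unfolding dirichlet_eigenfunction_def by blast
  moreover have "\<not> \<mu> < ground_level" if "dirichlet_eigenfunction V d \<mu> u" for \<mu> u
    using that dirichlet_solution_below(3)[OF half, of \<mu> u] unfolding dirichlet_eigenfunction_def by force
  then have "{\<mu> \<in> {\<mu>. \<exists>u. dirichlet_eigenfunction V d \<mu> u}. \<mu> < ground_level} = {}"
    by blast
  ultimately show ?thesis
    unfolding dirichlet_eigenvalue_def by (intro kth_smallestI) (blast, simp_all only: finite.emptyI card.empty)
qed

lemma dirichlet_eigenfunction_1:
  assumes half: "neumann_family (\<lambda>x. V (d / 2 - x)) (d / 2) e e'"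
    and incr: "mono_on {0..d/2} (\<lambda>x. V (d / 2 - x))"
    and u: "dirichlet_eigenfunction V d (neumann_family.ground_level (d / 2) e) u"
  shows "strictly_monotone_on {0..d/2} u" and "even_about_midpoint d u"
proof -
  interpret neumann_family "\<lambda>x. V (d / 2 - x)" "d / 2" e e' by (rule half)
  obtain v where v: "\<exists>x\<in>{0..d}. u x \<noteq> 0" "schroedinger_solution V d ground_level u v" "u 0 = 0" "u d = 0"
    using u unfolding dirichlet_eigenfunction_def by blast
  note mid = dirichlet_solution_below[OF half v(2-4,1) order_refl]
  show "even_about_midpoint d u"
    using symmetric_potential_even[OF v(2) less_imp_le[OF d] V sym mid(1)]
    by (simp add: even_about_midpoint_def)
  show "strictly_monotone_on {0..d/2} u"
  proof (rule strictly_monotone_on_if_derivative_sign[where S = "{0..d}"])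
    show "(u has_real_derivative v x) (at x within {0..d})" if "x \<in> {0..d/2}" for x
      using that by (intro schroedinger_solution_derivatives(1)[OF v(2)]) auto
    show "0 < u (d / 2) * v x" if x: "0 < x" "x < d / 2" for x
    proof -
      have "0 < (u (d / 2))\<^sup>2 * - e' ground_level (d / 2 - x)"
        using mid(2) x ground_state_decreasing[OF incr, of "d / 2 - x"] by (intro mult_pos_pos) auto
      moreover have "v x = - (u (d / 2) * e' ground_level (d / 2 - x))"
        using neumann_solution_multiple(2)[OF solution_on_half(2)[OF v(2)], of "d / 2 - x"] mid(1) x by simp
      ultimately show ?thesis
        by (simp add: power2_eq_square mult.assoc)
    qed
  qed (use d in auto)
qed

end

text \<open>Reflecting the ground state of the second potential gives a positive solution, for the first
  potential, of the mixed problem with the two boundary conditions exchanged.\<close>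
lemma ground_level_less_reflected:
  assumes "neumann_family Q L c c'" "neumann_family Q' L e e'"
    and Q': "\<And>x. x \<in> {0..L} \<Longrightarrow> Q x = Q' (L - x)"
    and incr: "strict_mono_on {0..L} Q"
  shows "neumann_family.ground_level L c < neumann_family.ground_level L e"
proof -
  interpret A: neumann_family Q L c c' by fact
  interpret B: neumann_family Q' L e e' by fact
  show ?thesis
  proof (rule A.ground_level_less_mixed_eigenvalue[OF incr])
    show "schroedinger_solution Q L B.ground_level (\<lambda>x. e B.ground_level (L - x)) (\<lambda>x. - e' B.ground_level (L - x))"
      using B.sol Q' by (rule schroedinger_solution_reflect)
  qed (use B.init B.ground_state in auto)
qed

theorem lemma2p2:
  fixes V\<^sub>0 :: "real \<Rightarrow> real" and d :: real
  assumes "d > 0"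
    and "continuous_on UNIV V\<^sub>0"
    and "\<And>x. V\<^sub>0 (- x) = V\<^sub>0 x"
    and "\<And>x. V\<^sub>0 (x + d) = V\<^sub>0 x"
  shows
    "(strict_mono_on {0..d/2} V\<^sub>0 \<longrightarrow>
        neumann_eigenvalue V\<^sub>0 d 2 < dirichlet_eigenvalue V\<^sub>0 d 1 \<and>
        (\<forall>u. neumann_eigenfunction V\<^sub>0 d (neumann_eigenvalue V\<^sub>0 d 2) u \<longrightarrow>
           strictly_monotone_on {0..d} u \<and> odd_about_midpoint d u))
     \<and>
     (strict_antimono_on {0..d/2} V\<^sub>0 \<longrightarrow>
        dirichlet_eigenvalue V\<^sub>0 d 1 < neumann_eigenvalue V\<^sub>0 d 2 \<and>
        (\<forall>u. dirichlet_eigenfunction V\<^sub>0 d (dirichlet_eigenvalue V\<^sub>0 d 1) u \<longrightarrow>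
           strictly_monotone_on {0..d/2} u \<and> even_about_midpoint d u))"
proof -
  define W where "W x = V\<^sub>0 (d / 2 - x)" for x
  have cont_V: "continuous_on S V\<^sub>0" for S
    using assms(2) continuous_on_subset by blast
  have cont_W: "continuous_on S W" for S
    unfolding W_def by (rule continuous_on_compose2[OF assms(2)]) (auto intro!: continuous_on_diff)
  have "V\<^sub>0 (d - x) = V\<^sub>0 x" for x
    using assms(3)[of x] assms(4)[of "- x"] by (simp add: add.commute)
  then interpret symmetric_potential V\<^sub>0 d
    using assms(1) cont_V by unfold_locales auto
  have "\<exists>u v. schroedinger_solution V\<^sub>0 d \<mu> u v \<and> u 0 = 1 \<and> v 0 = 0" for \<mu>
    using schroedinger_solution_exists[OF V, of \<mu> 1 0] d by (metis less_imp_le)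
  then obtain c c' where c: "\<And>\<mu>. schroedinger_solution V\<^sub>0 d \<mu> (c \<mu>) (c' \<mu>)"
    and c_init: "\<And>\<mu>. c \<mu> 0 = 1" "\<And>\<mu>. c' \<mu> 0 = 0"
    by metis
  have "\<exists>u v. schroedinger_solution W (d / 2) \<mu> u v \<and> u 0 = 1 \<and> v 0 = 0" for \<mu>
    using schroedinger_solution_exists[OF cont_W, of "d / 2" \<mu> 1 0] d
    by (metis less_imp_le half_gt_zero)
  then obtain e e' where e: "\<And>\<mu>. schroedinger_solution W (d / 2) \<mu> (e \<mu>) (e' \<mu>)"
    and e_init: "\<And>\<mu>. e \<mu> 0 = 1" "\<And>\<mu>. e' \<mu> 0 = 0"
    by metis
  have A: "neumann_family V\<^sub>0 (d / 2) c c'"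
    using d c_init by (intro neumann_family.intro solution_on_half(1) c cont_V) auto
  have B: "neumann_family W (d / 2) e e'"
    using d e_init by (intro neumann_family.intro e cont_W) auto
  have B': "neumann_family (\<lambda>x. V\<^sub>0 (d / 2 - x)) (d / 2) e e'"
    using B by (simp add: W_def[abs_def])
  note eigenvalues = neumann_eigenvalue_2_eq[OF c A] dirichlet_eigenvalue_1_eq[OF B']
  show ?thesis
  proof (intro conjI impI allI)
    assume incr: "strict_mono_on {0..d/2} V\<^sub>0"
    show "neumann_eigenvalue V\<^sub>0 d 2 < dirichlet_eigenvalue V\<^sub>0 d 1"
      unfolding eigenvalues using incr by (intro ground_level_less_reflected[OF A B]) (simp_all add: W_def)
    fix u assume "neumann_eigenfunction V\<^sub>0 d (neumann_eigenvalue V\<^sub>0 d 2) u"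
    then show "strictly_monotone_on {0..d} u" "odd_about_midpoint d u"
      using neumann_eigenfunction_2[OF A strict_mono_on_imp_mono_on[OF incr]] eigenvalues by simp_all
  next
    assume "strict_antimono_on {0..d/2} V\<^sub>0"
    then have incr: "strict_mono_on {0..d/2} W"
      by (auto simp: monotone_on_def W_def)
    show "dirichlet_eigenvalue V\<^sub>0 d 1 < neumann_eigenvalue V\<^sub>0 d 2"
      unfolding eigenvalues using incr by (intro ground_level_less_reflected[OF B A]) (simp_all add: W_def)
    have incr': "mono_on {0..d/2} (\<lambda>x. V\<^sub>0 (d / 2 - x))"
      using strict_mono_on_imp_mono_on[OF incr] by (simp add: W_def[abs_def])
    fix u assume "dirichlet_eigenfunction V\<^sub>0 d (dirichlet_eigenvalue V\<^sub>0 d 1) u"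
    then show "strictly_monotone_on {0..d/2} u" "even_about_midpoint d u"
      using dirichlet_eigenfunction_1[OF B' incr'] eigenvalues by simp_all
  qed
qed

end
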